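(* Let $G''$ be a digraph obtained from a digraph $G'$ by a T-operation. Then $X(G'')\simeq \Sigma X(G')$. Furthermore, with the vertices $t,t_1,t_2$ labelled as in gluing (A) of the definition of T-operation, if we identify $\Sigma X(G')$ with the subcomplex of $X(G'')$ given by $\{(t_2,t_1),(t,t_1)\}\ast X(G')$, then the natural inclusion map $\Sigma X(G')\hookrightarrow X(G'')$ is a homotopy equivalence.
   Context: A digraph has at most one edge $(v,w)$ from $v$ to $w$ for each ordered pair of vertices. For an edge $e=(v,w)$, $s(e)=v$ is its source and $t(e)=w$ its target. A simple path in a digraph is a sequence of edges $e_1,\dots,e_k$ with $s(e_{i+1})=t(e_i)$ for all $i<k$, such that $s(e_i)=s(e_j)$ or $t(e_i)=t(e_j)$ implies $i=j$, and which is not a cycle, i.e. $s(e_1)\neq t(e_k)$. A multipath of a digraph $G$ is a spanning subgraph each of whose connected components is either a single vertex or a simple path. The multipath complex $X(G)$ is the (abstract) simplicial complex whose simplices are the nonempty edge sets of multipaths of $G$ (the empty simplex corresponds to the multipath with no edges); topological statements refer to its geometric realization. $\Sigma$ denotes the topological (unreduced) suspension, i.e. the join with a two-point discrete space, and $\{a,b\}\ast K$ is the simplicial join of the discrete complex on two vertices $a,b$ with $K$. T-operation. Let $G'$ be a digraph with a vertex $v$ without self-loops, of valence $3$ (exactly three edges are incident to $v$), with indegree or outdegree of $v$ equal to $1$ (the indegree, resp. outdegree, of a vertex is the number of edges with that vertex as target, resp. source). Let $t\neq v$ be a vertex of $G'$ that is incident to exactly one edge of $G'$, this edge joining $t$ and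 $v$. Let $\mathtt{W}_2$ be the digraph with vertices $v_0,v_1,v_2,v_3$ and edges $(v_0,v_1),(v_1,v_2),(v_2,v_1),(v_2,v_3)$. The digraph $G''$ is obtained by gluing a copy of $\mathtt{W}_2$ to $G'$ as follows: (A) if the edge of $G'$ between $v$ and $t$ is $(v,t)$, identify $v_3$ with $v$ and $v_2$ with $t$, and write $t_1$ for $v_1$ and $t_2$ for $v_0$; so $G''$ is $G'$ with two new vertices $t_1,t_2$ and new edges $(t,v),(t_1,t),(t,t_1),(t_2,t_1)$; (B) if the edge of $G'$ between $v$ and $t$ is $(t,v)$, identify $v_0$ with $v$ and $v_1$ with $t$; so $G''$ is $G'$ with two new vertices (the images of $v_2$ and $v_3$) and the new edges $(v,t),(t,v_2),(v_2,t),(v_2,v_3)$. In either case $G''$ is said to be obtained from $G'$ by a T-operation. *)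

theory Defs
  imports "HOL-Analysis.Analysis" "Graph_Theory.Digraph_Component"
begin

section \<open>Multipaths\<close>

text \<open>
  A digraph is a \<open>pair_pre_digraph\<close> satisfying \<open>pair_wf_digraph\<close>: its arcs are ordered pairs of
  vertices, loops are allowed, and the arc \<open>e\<close> has source \<open>fst e\<close> and target \<open>snd e\<close>. The qualified
  name \<open>Digraph_Component.connected\<close> (weak connectedness, nonempty vertex set) is needed because
  \<open>connected\<close> also names the topological notion.
\<close>

definition simple_path :: "'a pair_pre_digraph \<Rightarrow> ('a \<times> 'a) list \<Rightarrow> bool" where
  "simple_path G p \<longleftrightarrow>
     p \<noteq> [] \<and> set p \<subseteq> parcs G \<and>
     (\<forall>i. Suc i < length p \<longrightarrow> fst (p ! Suc i) = snd (p ! i)) \<and>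
     (\<forall>i<length p. \<forall>j<length p. fst (p ! i) = fst (p ! j) \<or> snd (p ! i) = snd (p ! j) \<longrightarrow> i = j) \<and>
     fst (hd p) \<noteq> snd (last p)"

definition connected_component_of_digraph ::
    "'a pair_pre_digraph \<Rightarrow> ('a, 'a \<times> 'a) pre_digraph \<Rightarrow> bool" where
  "connected_component_of_digraph H C \<longleftrightarrow>
     pre_digraph.max_subgraph (with_proj H) Digraph_Component.connected C"

definition multipath :: "'a pair_pre_digraph \<Rightarrow> 'a pair_pre_digraph \<Rightarrow> bool" where
  "multipath G H \<longleftrightarrow>
     Digraph_Component.spanning (with_proj H) (with_proj G) \<and>
     (\<forall>C. connected_component_of_digraph H C \<longrightarrow>
        (\<exists>u. verts C = {u} \<and> arcs C = {}) \<or>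
        (\<exists>p. simple_path H p \<and> arcs C = set p \<and> verts C = fst ` set p \<union> snd ` set p))"

text \<open>
  Simplices are finite. The finiteness condition is automatic if \<open>G\<close> is finite; it only makes the
  definition meaningful for infinite digraphs as well.
\<close>

definition multipath_complex :: "'a pair_pre_digraph \<Rightarrow> ('a \<times> 'a) set set" where
  "multipath_complex G = {parcs H | H. multipath G H \<and> finite (parcs H) \<and> parcs H \<noteq> {}}"


section \<open>Simplicial complexes, given by their sets of nonempty simplices\<close>

definition simplicial_join :: "'b set set \<Rightarrow> 'b set set \<Rightarrow> 'b set set" where
  "simplicial_join K L = {\<sigma> \<union> \<tau> | \<sigma> \<tau>. \<sigma> \<in> insert {} K \<and> \<tau> \<in> insert {} L} - {{}}"

text \<open>
  Points of the realization are given by barycentric coordinates. The topology is the weak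
  topology: a set is open iff its intersection with every closed simplex is open there, where
  closed simplices have the Euclidean topology.
\<close>

definition closed_simplex :: "'b set \<Rightarrow> ('b \<Rightarrow> real) set" where
  "closed_simplex \<sigma> = {x. (\<forall>a. 0 \<le> x a) \<and> (\<forall>a. a \<notin> \<sigma> \<longrightarrow> x a = 0) \<and> (\<Sum>a\<in>\<sigma>. x a) = 1}"

definition realization :: "'b set set \<Rightarrow> ('b \<Rightarrow> real) topology" where
  "realization K = topology (\<lambda>U. U \<subseteq> (\<Union>\<sigma>\<in>K. closed_simplex \<sigma>) \<and>
     (\<forall>\<sigma>\<in>K. openin (top_of_set (closed_simplex \<sigma>)) (U \<inter> closed_simplex \<sigma>)))"

lemma openin_realization:
  "openin (realization K) U \<longleftrightarrow> U \<subseteq> (\<Union>\<sigma>\<in>K. closed_simplex \<sigma>) \<and>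
     (\<forall>\<sigma>\<in>K. openin (top_of_set (closed_simplex \<sigma>)) (U \<inter> closed_simplex \<sigma>))"
proof -
  let ?P = "\<lambda>U. U \<subseteq> (\<Union>\<sigma>\<in>K. closed_simplex \<sigma>) \<and>
     (\<forall>\<sigma>\<in>K. openin (top_of_set (closed_simplex \<sigma>)) (U \<inter> closed_simplex \<sigma>))"
  have "istopology ?P"
    unfolding istopology_def
  proof (intro conjI allI impI)
    fix S T assume "?P S" "?P T"
    moreover have "S \<inter> T \<inter> c = (S \<inter> c) \<inter> (T \<inter> c)" for c by blast
    ultimately show "S \<inter> T \<subseteq> (\<Union>\<sigma>\<in>K. closed_simplex \<sigma>)"
      and "\<forall>\<sigma>\<in>K. openin (top_of_set (closed_simplex \<sigma>)) (S \<inter> T \<inter> closed_simplex \<sigma>)"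
      by (blast, metis openin_Int)
  next
    fix \<K> assume *: "\<forall>S\<in>\<K>. ?P S"
    then show "\<Union>\<K> \<subseteq> (\<Union>\<sigma>\<in>K. closed_simplex \<sigma>)" by blast
    have "\<Union>\<K> \<inter> c = (\<Union>S\<in>\<K>. S \<inter> c)" for c by blast
    moreover have "openin (top_of_set (closed_simplex \<sigma>)) (\<Union>S\<in>\<K>. S \<inter> closed_simplex \<sigma>)"
      if "\<sigma> \<in> K" for \<sigma>
      using * that by (intro openin_Union) blast
    ultimately show "\<forall>\<sigma>\<in>K. openin (top_of_set (closed_simplex \<sigma>)) (\<Union>\<K> \<inter> closed_simplex \<sigma>)"
      by simp
  qed
  then show ?thesis
    unfolding realization_def by (simp add: topology_inverse')
qed


section \<open>Suspension\<close>

text \<open>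
  The unreduced suspension of \<open>X\<close> is the cylinder \<open>X \<times> [-1,1]\<close> with each of its two ends collapsed
  to a pole. Both poles are present even if \<open>X\<close> is empty, as in the join with a two-point space.
\<close>

datatype 'b susp = South | North | Band 'b real

definition susp_proj :: "'b \<times> real \<Rightarrow> 'b susp" where
  "susp_proj = (\<lambda>(x, s). if s \<le> -1 then South else if 1 \<le> s then North else Band x s)"

definition susp_carrier :: "'b set \<Rightarrow> 'b susp set" where
  "susp_carrier S = {South, North} \<union> {Band x s | x s. x \<in> S \<and> -1 < s \<and> s < 1}"

definition suspension :: "'b topology \<Rightarrow> 'b susp topology" where
  "suspension X = topology (\<lambda>U. U \<subseteq> susp_carrier (topspace X) \<and>
     openin (prod_topology X (top_of_set {-1..1}))
       {p \<in> topspace X \<times> {-1..1}. susp_proj p \<in> U})"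

lemma openin_suspension:
  "openin (suspension X) U \<longleftrightarrow> U \<subseteq> susp_carrier (topspace X) \<and>
     openin (prod_topology X (top_of_set {-1..1}))
       {p \<in> topspace X \<times> {-1..1}. susp_proj p \<in> U}"
proof -
  let ?Q = "\<lambda>U. {p \<in> topspace X \<times> {-1..1}. susp_proj p \<in> U}"
  have "istopology (\<lambda>U. U \<subseteq> susp_carrier (topspace X) \<and>
          openin (prod_topology X (top_of_set {-1..1})) (?Q U))"
    unfolding istopology_def
  proof (intro conjI allI impI; (elim conjE)?)
    fix S T assume "openin (prod_topology X (top_of_set {-1..1})) (?Q S)"
      "openin (prod_topology X (top_of_set {-1..1})) (?Q T)"
    moreover have "?Q (S \<inter> T) = ?Q S \<inter> ?Q T" by blast
    ultimately show "openin (prod_topology X (top_of_set {-1..1})) (?Q (S \<inter> T))"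
      by (simp only: openin_Int)
  next
    fix \<K> assume *: "\<forall>S\<in>\<K>. S \<subseteq> susp_carrier (topspace X) \<and>
      openin (prod_topology X (top_of_set {-1..1})) (?Q S)"
    then show "\<Union>\<K> \<subseteq> susp_carrier (topspace X)" by blast
    have "?Q (\<Union>\<K>) = (\<Union>S\<in>\<K>. ?Q S)" by blast
    with * show "openin (prod_topology X (top_of_set {-1..1})) (?Q (\<Union>\<K>))"
      by (simp only:) (blast intro: openin_Union)
  qed blast
  then show ?thesis
    unfolding suspension_def by (simp add: topology_inverse')
qed

text \<open>
  For vertices \<open>a \<noteq> b\<close> not in \<open>K\<close>, this is the canonical identification of the suspension of the
  realization of \<open>K\<close> with the realization of the join \<open>{a,b} * K\<close>: the poles go to \<open>a\<close> and \<open>b\<close>, and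
  the segment over \<open>x\<close> goes linearly from \<open>a\<close> to \<open>x\<close> and then from \<open>x\<close> to \<open>b\<close>.
\<close>

definition vertex_point :: "'b \<Rightarrow> 'b \<Rightarrow> real" where
  "vertex_point a = (\<lambda>c. if c = a then 1 else 0)"

primrec susp_to_join :: "'b \<Rightarrow> 'b \<Rightarrow> ('b \<Rightarrow> real) susp \<Rightarrow> 'b \<Rightarrow> real" where
  "susp_to_join a b South = vertex_point a"
| "susp_to_join a b North = vertex_point b"
| "susp_to_join a b (Band x s) =
     (\<lambda>c. max 0 (- s) * vertex_point a c + max 0 s * vertex_point b c + (1 - \<bar>s\<bar>) * x c)"


section \<open>Homotopy equivalences\<close>

text \<open>
  The library only has the relation \<open>homotopy_equivalent_space\<close>, whose definition asserts that a map
  \<open>f\<close> as follows exists.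
\<close>

definition homotopy_equivalence_map :: "'b topology \<Rightarrow> 'c topology \<Rightarrow> ('b \<Rightarrow> 'c) \<Rightarrow> bool" where
  "homotopy_equivalence_map X Y f \<longleftrightarrow>
     continuous_map X Y f \<and>
     (\<exists>g. continuous_map Y X g \<and>
        homotopic_with (\<lambda>_. True) X X (g \<circ> f) id \<and>
        homotopic_with (\<lambda>_. True) Y Y (f \<circ> g) id)"


section \<open>The T-operation\<close>

definition incident_arcs :: "'a pair_pre_digraph \<Rightarrow> 'a \<Rightarrow> ('a \<times> 'a) set" where
  "incident_arcs G v = {e \<in> parcs G. fst e = v \<or> snd e = v}"

definition T_vertex :: "'a pair_pre_digraph \<Rightarrow> 'a \<Rightarrow> bool" where
  "T_vertex G v \<longleftrightarrow>
     v \<in> pverts G \<and> (v, v) \<notin> parcs G \<and> card (incident_arcs G v) = 3 \<and>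
     (in_degree (with_proj G) v = 1 \<or> out_degree (with_proj G) v = 1)"

definition T_operation_A ::
    "'a pair_pre_digraph \<Rightarrow> 'a \<Rightarrow> 'a \<Rightarrow> 'a \<Rightarrow> 'a \<Rightarrow> 'a pair_pre_digraph \<Rightarrow> bool" where
  "T_operation_A G' v t t1 t2 G'' \<longleftrightarrow>
     T_vertex G' v \<and> t \<in> pverts G' \<and> t \<noteq> v \<and> incident_arcs G' t = {(v, t)} \<and>
     t1 \<notin> pverts G' \<and> t2 \<notin> pverts G' \<and> t1 \<noteq> t2 \<and>
     G'' = \<lparr> pverts = pverts G' \<union> {t1, t2},
             parcs = parcs G' \<union> {(t, v), (t1, t), (t, t1), (t2, t1)} \<rparr>"

text \<open>In case (B) the vertices \<open>v\<^sub>2\<close> and \<open>v\<^sub>3\<close> of the glued graph are called \<open>w2\<close> and \<open>w3\<close>.\<close>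

definition T_operation_B ::
    "'a pair_pre_digraph \<Rightarrow> 'a \<Rightarrow> 'a \<Rightarrow> 'a \<Rightarrow> 'a \<Rightarrow> 'a pair_pre_digraph \<Rightarrow> bool" where
  "T_operation_B G' v t w2 w3 G'' \<longleftrightarrow>
     T_vertex G' v \<and> t \<in> pverts G' \<and> t \<noteq> v \<and> incident_arcs G' t = {(t, v)} \<and>
     w2 \<notin> pverts G' \<and> w3 \<notin> pverts G' \<and> w2 \<noteq> w3 \<and>
     G'' = \<lparr> pverts = pverts G' \<union> {w2, w3},
             parcs = parcs G' \<union> {(v, t), (t, w2), (w2, t), (w2, w3)} \<rparr>"

definition T_operation :: "'a pair_pre_digraph \<Rightarrow> 'a pair_pre_digraph \<Rightarrow> bool" where
  "T_operation G' G'' \<longleftrightarrow>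
     (\<exists>v t t1 t2. T_operation_A G' v t t1 t2 G'') \<or> (\<exists>v t w2 w3. T_operation_B G' v t w2 w3 G'')"

end

theory Submission
  imports Defs
begin

text \<open>
  A finite nonempty set of arcs is a simplex of the multipath complex iff its arcs have pairwise
  distinct sources, pairwise distinct targets, and form no directed cycle. In case (A) put
  \<open>d = (t2, t1)\<close> and \<open>g = (t, t1)\<close>. The arc \<open>d\<close> is incompatible only with \<open>g\<close>, whereas each of the two
  remaining new arcs \<open>(t, v)\<close> and \<open>(t1, t)\<close> is incompatible with \<open>g\<close>. Hence every simplex that contains
  one of these two arcs stays a simplex when \<open>d\<close> is added, so the simplicial map which sends both
  arcs to \<open>d\<close> is contiguous to the identity and retracts \<open>X(G'')\<close> onto the subcomplex without them.
  As \<open>d\<close> and \<open>g\<close> exclude each other but are compatible with every simplex of \<open>X(G')\<close>, this subcomplex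
  is the join \<open>{d, g} * X(G')\<close>. Case (B) is obtained by reversing all arcs, with \<open>d = (w2, w3)\<close> and
  \<open>g = (w2, t)\<close>.
\<close>

section \<open>Multipaths as sets of arcs\<close>

text \<open>For finite \<open>S\<close> these are the disjoint unions of directed paths: in- and
  outdegrees of at most one leave only paths and cycles, and \<open>acyclic\<close> removes the
  cycles, loops included.\<close>

definition linear_arcs :: "('a \<times> 'a) set \<Rightarrow> bool" where
  "linear_arcs S \<longleftrightarrow> inj_on fst S \<and> inj_on snd S \<and> acyclic S"

lemma linear_arcs_subset: "linear_arcs S \<Longrightarrow> T \<subseteq> S \<Longrightarrow> linear_arcs T"
  unfolding linear_arcs_def by (meson acyclic_subset inj_on_subset)

lemma linear_arcs_empty: "linear_arcs {}"
  by (simp add: linear_arcs_def acyclic_def)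

section \<open>Arc sets of multipaths are linear\<close>

text \<open>Distinctness of sources and of targets is part of \<open>simple_path\<close>. Acyclicity
  comes from a potential: the number of arcs still ahead on the path drops along every arc.\<close>

lemma linear_arcs_simple_path:
  assumes "simple_path G p"
  shows "linear_arcs (set p)"
proof -
  have ne: "p \<noteq> []" and chain: "\<And>i. Suc i < length p \<Longrightarrow> fst (p ! Suc i) = snd (p ! i)"
    and inj: "\<And>i j. i < length p \<Longrightarrow> j < length p \<Longrightarrow>
        fst (p ! i) = fst (p ! j) \<or> snd (p ! i) = snd (p ! j) \<Longrightarrow> i = j"
    and open_path: "fst (p ! 0) \<noteq> snd (p ! (length p - 1))"
    using assms unfolding simple_path_def by (auto simp: hd_conv_nth last_conv_nth)
  \<comment> \<open>The number of arcs of \<open>p\<close> from \<open>x\<close> onwards. The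
    default 0 serves the final vertex, where no arc starts.\<close>
  define rank where
    "rank x = (if \<exists>i<length p. fst (p ! i) = x
               then length p - (THE i. i < length p \<and> fst (p ! i) = x) else 0)" for x
  have rank_fst: "rank (fst (p ! i)) = length p - i" if "i < length p" for i
  proof -
    have "(THE j. j < length p \<and> fst (p ! j) = fst (p ! i)) = i"
      using that inj by (intro the_equality) auto
    then show ?thesis using that by (auto simp: rank_def)
  qed
  have rank_snd: "rank (snd (p ! i)) < rank (fst (p ! i))" if i: "i < length p" for i
  proof (cases "Suc i < length p")
    case True
    then have "rank (snd (p ! i)) = length p - Suc i"
      using chain[of i] rank_fst[of "Suc i"] by simp
    then show ?thesis using rank_fst[OF i] True by simp
  next
    case False
    then have i_last: "i = length p - 1" using i by simp
    \<comment> \<open>Arc 0 does not start at the final target, because the path is open. If arc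
      \<open>Suc k\<close> did, arc \<open>k\<close> would end there, so \<open>k = i\<close>, which
      is already the last index.\<close>
    have "fst (p ! j) \<noteq> snd (p ! i)" if "j < length p" for j
    proof (cases j)
      case 0
      then show ?thesis using open_path i_last by simp
    next
      case (Suc k)
      then show ?thesis using chain[of k] inj[of k i] that i i_last by auto
    qed
    then have "rank (snd (p ! i)) = 0" by (auto simp: rank_def)
    then show ?thesis using rank_fst[OF i] i by simp
  qed
  have "acyclic (set p)"
  proof (rule acyclicI_order)
    fix a b assume "(a, b) \<in> set p"
    then obtain i where "i < length p" "p ! i = (a, b)" by (auto simp: in_set_conv_nth)
    then show "rank b < rank a" using rank_snd[of i] by simp
  qed
  moreover have "e = f" if "e \<in> set p" "f \<in> set p" "fst e = fst f \<or> snd e = snd f" for e f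
  proof -
    obtain i j where "i < length p" "p ! i = e" "j < length p" "p ! j = f"
      using \<open>e \<in> set p\<close> \<open>f \<in> set p\<close> by (auto simp: in_set_conv_nth)
    then show ?thesis using that(3) inj[of i j] by auto
  qed
  ultimately show ?thesis by (auto simp: linear_arcs_def intro!: inj_onI)
qed

text \<open>The vertices weakly reachable from \<open>u\<close> induce the component: no arc crosses
  the boundary of this set, and a connected subgraph containing \<open>u\<close> cannot exceed
  it.\<close>

lemma obtain_connected_component:
  assumes "pair_wf_digraph H" and u: "u \<in> pverts H"
  obtains C where "connected_component_of_digraph H C" and "u \<in> verts C"
    and "arcs C = {e \<in> parcs H. fst e \<in> verts C}"
    and "\<And>x y. (x, y) \<in> parcs H \<Longrightarrow> x \<in> verts C \<longleftrightarrow> y \<in> verts C"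
proof -
  interpret pair_wf_digraph H by fact
  define V where "V = {w. (u, w) \<in> ((parcs H)\<^sup>s)\<^sup>*}"
  define C :: "('a, 'a \<times> 'a) pre_digraph"
    where "C = \<lparr>verts = V, arcs = {e \<in> parcs H. fst e \<in> V}, tail = fst, head = snd\<rparr>"
  have C_simps [simp]: "verts C = V" "arcs C = {e \<in> parcs H. fst e \<in> V}" "tail C = fst" "head C = snd"
    by (simp_all add: C_def)
  have uV: "u \<in> V" by (simp add: V_def)
  have closed: "x \<in> V \<longleftrightarrow> y \<in> V" if "(x, y) \<in> parcs H" for x y
    using that by (auto simp: V_def symcl_def intro: rtrancl_into_rtrancl)
  have V_verts: "V \<subseteq> pverts H"
  proof
    fix w assume "w \<in> V"
    then have "(u, w) \<in> ((parcs H)\<^sup>s)\<^sup>*" by (simp add: V_def)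
    then show "w \<in> pverts H"
      by (induct rule: rtrancl_induct) (auto simp: u symcl_def dest: in_arcsD1 in_arcsD2)
  qed
  have wf_C: "wf_digraph C" by unfold_locales (use closed in auto)
  have sub: "subgraph C (with_proj H)"
    unfolding subgraph_def using V_verts wf_C
    by (auto simp: compatible_def) (rule wf_digraph_axioms)
  have ends: "arcs_ends C = {e \<in> parcs H. fst e \<in> V}"
    by (auto simp: arcs_ends_conv image_def)
  \<comment> \<open>\<open>rtrancl_on\<close> demands that intermediate vertices lie in
    \<open>V\<close>; they do, since every vertex on a walk from \<open>u\<close> is itself
    reachable.\<close>
  have reach: "(u, w) \<in> rtrancl_on V ((arcs_ends C)\<^sup>s)" if "w \<in> V" for w
  proof -
    have "(u, w) \<in> ((parcs H)\<^sup>s)\<^sup>*" using that by (simp add: V_def)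
    then show ?thesis
    proof (induct rule: rtrancl_induct)
      case base
      then show ?case by (simp add: uV)
    next
      case (step y z)
      then have "y \<in> V" "z \<in> V" by (auto simp: V_def intro: rtrancl_into_rtrancl)
      moreover from this have "(y, z) \<in> (arcs_ends C)\<^sup>s"
        using step(2) by (auto simp: ends symcl_def)
      ultimately show ?case using rtrancl_on_into_rtrancl_on[OF step(3)] by blast
    qed
  qed
  have conn: "Digraph_Component.connected C"
    unfolding connected_conv
  proof (intro conjI ballI)
    show "verts C \<noteq> {}" using uV by auto
    fix x y assume xy: "x \<in> verts C" "y \<in> verts C"
    have "sym ((arcs_ends C)\<^sup>s)" by (auto simp: sym_def symcl_def)
    then have "sym (rtrancl_on V ((arcs_ends C)\<^sup>s))" by (rule rtrancl_on_sym)
    then show "(x, y) \<in> rtrancl_on (verts C) ((arcs_ends C)\<^sup>s)"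
      using reach xy by (auto dest: symD intro: rtrancl_on_trans)
  qed
  have max: "H' = C" if H': "subgraph C H'" "subgraph H' (with_proj H)"
    "Digraph_Component.connected H'" for H'
  proof -
    have ends': "arcs_ends H' \<subseteq> parcs H"
      using H'(2) by (auto simp: subgraph_def compatible_def arcs_ends_conv)
    have "verts H' \<subseteq> V"
    proof
      fix w assume "w \<in> verts H'"
      moreover have "u \<in> verts H'" using H'(1) uV by (auto simp: subgraph_def)
      ultimately have "(u, w) \<in> rtrancl_on (verts H') ((arcs_ends H')\<^sup>s)"
        using H'(3) by (simp add: connected_conv)
      then have "(u, w) \<in> ((arcs_ends H')\<^sup>s)\<^sup>*" by (rule rtrancl_on_rtranclI)
      moreover have "(arcs_ends H')\<^sup>s \<subseteq> (parcs H)\<^sup>s" using ends' by (auto simp: symcl_def)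
      ultimately show "w \<in> V" unfolding V_def by (auto dest: rtrancl_mono)
    qed
    then have "verts H' = verts C" using H'(1) by (auto simp: subgraph_def)
    moreover have "tail H' = fst" "head H' = snd"
      using H'(2) by (auto simp: subgraph_def compatible_def)
    moreover have "arcs H' = arcs C"
    proof
      show "arcs C \<subseteq> arcs H'" using H'(1) by (auto simp: subgraph_def)
      interpret H': wf_digraph H' using H'(2) by (simp add: subgraph_def)
      show "arcs H' \<subseteq> arcs C"
        using H'(2) H'.tail_in_verts \<open>verts H' = verts C\<close> \<open>tail H' = fst\<close>
        by (auto simp: subgraph_def)
    qed
    ultimately show ?thesis by (intro pre_digraph.equality) simp_all
  qed
  have "connected_component_of_digraph H C"
    unfolding connected_component_of_digraph_def pre_digraph.max_subgraph_def
    using sub conn max by blast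
  then show thesis using that[of C] uV closed by simp
qed

text \<open>All conditions are local to components: arcs with a common source or target lie in the
  same component, and a closed walk never leaves one. On a path component they hold by
  \<open>linear_arcs_simple_path\<close>.\<close>

lemma linear_arcs_multipath:
  assumes "multipath G H"
  shows "linear_arcs (parcs H)"
proof -
  have H: "pair_wf_digraph H"
    using assms by (simp add: multipath_def Digraph_Component.spanning_def subgraph_def wf_digraph_wp_iff)
  interpret pair_wf_digraph H by fact
  have component: "\<exists>V. x \<in> V \<and> (\<forall>e \<in> parcs H. fst e \<in> V \<longleftrightarrow> snd e \<in> V) \<and>
      linear_arcs {e \<in> parcs H. fst e \<in> V}" if x: "x \<in> pverts H" for x
  proof -
    obtain C where C: "connected_component_of_digraph H C" "x \<in> verts C"
      "arcs C = {e \<in> parcs H. fst e \<in> verts C}"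
      "\<And>x y. (x, y) \<in> parcs H \<Longrightarrow> x \<in> verts C \<longleftrightarrow> y \<in> verts C"
      using obtain_connected_component[OF H x] by blast
    have "linear_arcs (arcs C)"
      using C(1) assms linear_arcs_simple_path unfolding multipath_def
      by (metis linear_arcs_empty)
    then show ?thesis using C(2-) by (intro exI[of _ "verts C"]) auto
  qed
  have "e = e'" if ee: "e \<in> parcs H" "e' \<in> parcs H" "fst e = fst e' \<or> snd e = snd e'" for e e'
  proof -
    obtain V where V: "fst e \<in> V" "\<forall>e \<in> parcs H. fst e \<in> V \<longleftrightarrow> snd e \<in> V"
      "linear_arcs {e \<in> parcs H. fst e \<in> V}"
      using component[OF arc_fst_in_verts[OF ee(1)]] by blast
    have "fst e' \<in> V" using V(1,2) ee by metis
    then have "e \<in> {e \<in> parcs H. fst e \<in> V}" "e' \<in> {e \<in> parcs H. fst e \<in> V}"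
      using V(1) ee by auto
    then show ?thesis using V(3) ee(3) unfolding linear_arcs_def by (meson inj_onD)
  qed
  moreover have "acyclic (parcs H)"
    unfolding acyclic_def
  proof (intro allI notI)
    fix x assume cyc: "(x, x) \<in> (parcs H)\<^sup>+"
    then obtain y where "(x, y) \<in> parcs H" by (blast dest: tranclD)
    then have "x \<in> pverts H" by (rule in_arcsD1)
    then obtain V where V: "x \<in> V" "\<forall>e \<in> parcs H. fst e \<in> V \<longleftrightarrow> snd e \<in> V"
      "linear_arcs {e \<in> parcs H. fst e \<in> V}"
      using component[OF \<open>x \<in> pverts H\<close>] by blast
    let ?A = "{e \<in> parcs H. fst e \<in> V}"
    \<comment> \<open>A walk that starts in \<open>V\<close> uses only arcs of the component, so a
      cycle through \<open>x\<close> would already be a cycle there.\<close>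
    have "(x, y) \<in> ?A\<^sup>+ \<and> y \<in> V" if "(x, y) \<in> (parcs H)\<^sup>+" for y
      using that
    proof (induct rule: trancl_induct)
      case (base y)
      then show ?case using V by force
    next
      case (step y z)
      then have "(y, z) \<in> ?A" "z \<in> V" using V by force+
      then show ?case using step by (auto intro: trancl_into_trancl)
    qed
    then show False using cyc V(3) by (auto simp: linear_arcs_def acyclic_def)
  qed
  ultimately show ?thesis by (auto simp: linear_arcs_def inj_on_def)
qed

section \<open>Linear arc sets are multipaths\<close>

lemma chain_trancl:
  assumes "set p \<subseteq> F" "successively (\<lambda>e f. fst f = snd e) p" "i \<le> j" "j < length p"
  shows "(fst (p ! i), snd (p ! j)) \<in> F\<^sup>+"
  using assms(3,4)
proof (induct j rule: dec_induct)
  case base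
  then have "p ! i \<in> F" using assms(1) by (auto dest: nth_mem)
  then show ?case by (metis prod.collapse r_into_trancl)
next
  case (step n)
  then have "p ! Suc n \<in> F" using assms(1) by (auto dest: nth_mem)
  moreover have "fst (p ! Suc n) = snd (p ! n)"
    using assms(2) step by (auto simp: successively_conv_nth)
  ultimately show ?case using step
    by (metis Suc_lessD prod.collapse trancl.trancl_into_trancl)
qed

text \<open>Take a longest chain \<open>p\<close>; acyclicity forbids repeated arcs, which bounds
  the length. Maximality and the degree bounds force every arc touching \<open>p\<close> into
  \<open>p\<close>, and connectedness spreads this to all of \<open>C\<close>.\<close>

lemma connected_linear_arcs_path:
  assumes "wf_digraph C" and [simp]: "tail C = fst" "head C = snd"
    and conn: "Digraph_Component.connected C"
    and fin: "finite (arcs C)" and lin: "linear_arcs (arcs C)" and ne: "arcs C \<noteq> {}"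
    and sub: "arcs C \<subseteq> parcs H"
  shows "\<exists>p. simple_path H p \<and> arcs C = set p \<and> verts C = fst ` set p \<union> snd ` set p"
proof -
  interpret wf_digraph C by fact
  let ?chain = "successively (\<lambda>e f. fst f = (snd e :: 'a))"
  have inj: "inj_on fst (arcs C)" "inj_on snd (arcs C)" and acyc: "acyclic (arcs C)"
    using lin by (auto simp: linear_arcs_def)
  have separated: "fst (p ! i) \<noteq> snd (p ! j)"
    if "set p \<subseteq> arcs C" "?chain p" "i \<le> j" "j < length p" for p i j
    using chain_trancl[OF that] acyc by (auto simp: acyclic_def)
  \<comment> \<open>For \<open>j = Suc k\<close> the source of arc \<open>j\<close> is the target of
    arc \<open>k\<close>, and \<open>i \<le> k\<close>, so \<open>separated\<close> applies.\<close>
  have nth_inj: "fst (p ! i) \<noteq> fst (p ! j)"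
    if p: "set p \<subseteq> arcs C" "?chain p" "i < j" "j < length p" for p i j
  proof (cases j)
    case (Suc k)
    then show ?thesis using separated[OF p(1,2), of i k] p by (auto simp: successively_conv_nth)
  qed (use p in simp)
  have dist: "distinct p" if "set p \<subseteq> arcs C" "?chain p" for p
    unfolding distinct_conv_nth using nth_inj[OF that] by (metis nat_neq_iff)
  have bound: "length p \<le> card (arcs C)" if "set p \<subseteq> arcs C \<and> ?chain p" for p
    using that dist[of p] fin by (metis card_mono distinct_card)
  obtain e where "e \<in> arcs C" using ne by blast
  then have "set [e] \<subseteq> arcs C \<and> ?chain [e]" by simp
  with bound obtain p where "set p \<subseteq> arcs C \<and> ?chain p"
    and "\<forall>q. set q \<subseteq> arcs C \<and> ?chain q \<longrightarrow> length q \<le> length p"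
    using ex_has_greatest_nat[of "\<lambda>p. set p \<subseteq> arcs C \<and> ?chain p" "[e]" length "Suc (card (arcs C))"]
    by (auto simp: less_Suc_eq_le)
  then have p: "set p \<subseteq> arcs C" "?chain p"
    and maximal: "\<And>q. set q \<subseteq> arcs C \<Longrightarrow> ?chain q \<Longrightarrow> length q \<le> length p"
    by auto
  have "p \<noteq> []" using maximal[of "[e]"] \<open>e \<in> arcs C\<close> by auto
  \<comment> \<open>An arc that continues \<open>p\<close> at either end would give a longer
    chain.\<close>
  have no_append: "fst f \<noteq> snd (last p)" if "f \<in> arcs C" for f
    using maximal[of "p @ [f]"] p that by (auto simp: successively_append_iff)
  have no_cons: "snd f \<noteq> fst (hd p)" if "f \<in> arcs C" for f
    using maximal[of "f # p"] p that by (auto simp: successively_Cons)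
  let ?V = "fst ` set p \<union> snd ` set p"
  have absorb: "f \<in> set p" if f: "f \<in> arcs C" and touch: "fst f \<in> ?V \<or> snd f \<in> ?V" for f
  proof -
    have *: "f \<in> set p" if "fst f = fst g \<or> snd f = snd g" "g \<in> set p" for g
      using that f p(1) inj by (metis inj_onD subsetD)
    \<comment> \<open>The arc of \<open>p\<close> that ends where \<open>f\<close> starts is not the
      last one, and its successor has the same source as \<open>f\<close>, hence equals
      \<open>f\<close>. The case below is dual, with the predecessor.\<close>
    have "f \<in> set p" if g: "fst f = snd g" "g \<in> set p" for g
    proof -
      obtain i where i: "i < length p" "g = p ! i" using g by (auto simp: in_set_conv_nth)
      have "Suc i < length p"
      proof (rule ccontr)
        assume "\<not> Suc i < length p"
        then have "i = length p - 1" using i by simp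
        then show False using no_append[OF f] g i \<open>p \<noteq> []\<close> by (simp add: last_conv_nth)
      qed
      then show ?thesis
        using p(2) g i by (intro *[of "p ! Suc i"]) (auto simp: successively_conv_nth)
    qed
    moreover have "f \<in> set p" if g: "snd f = fst g" "g \<in> set p" for g
    proof -
      obtain i where i: "i < length p" "g = p ! i" using g by (auto simp: in_set_conv_nth)
      have "i \<noteq> 0"
        using no_cons[OF f] g i \<open>p \<noteq> []\<close> by (intro notI) (simp add: hd_conv_nth)
      then obtain k where "i = Suc k" by (cases i) auto
      then show ?thesis
        using p(2) g i by (intro *[of "p ! k"]) (auto simp: successively_conv_nth)
    qed
    ultimately show ?thesis using touch * by blast
  qed
  have V_sub: "?V \<subseteq> verts C" using p(1) tail_in_verts head_in_verts by auto
  \<comment> \<open>Each undirected step from a vertex of \<open>p\<close> runs along an arc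
    touching \<open>p\<close>, hence along an arc of \<open>p\<close>.\<close>
  have V_sup: "verts C \<subseteq> ?V"
  proof
    fix w assume w: "w \<in> verts C"
    have u: "fst (hd p) \<in> ?V" using \<open>p \<noteq> []\<close> by auto
    then have "(fst (hd p), w) \<in> rtrancl_on (verts C) ((arcs_ends C)\<^sup>s)"
      using conn w V_sub unfolding connected_conv by blast
    then show "w \<in> ?V"
    proof (induct rule: rtrancl_on_induct)
      case base
      then show ?case using u by simp
    next
      case (step y z)
      then obtain f where "f \<in> arcs C" "(y = fst f \<and> z = snd f) \<or> (z = fst f \<and> y = snd f)"
        by (auto simp: symcl_def arcs_ends_conv)
      moreover from this have "f \<in> set p" using absorb step by blast
      ultimately show ?case by auto
    qed
  qed
  have "arcs C \<subseteq> set p" using absorb V_sup tail_in_verts by force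
  moreover have "simple_path H p"
    unfolding simple_path_def
  proof (intro conjI allI impI)
    show "p \<noteq> []" by fact
    show "set p \<subseteq> parcs H" using p(1) sub by blast
    show "fst (hd p) \<noteq> snd (last p)"
      using no_append p(1) \<open>p \<noteq> []\<close> hd_in_set by blast
    fix i
    show "fst (p ! Suc i) = snd (p ! i)" if "Suc i < length p"
      using that p(2) by (auto simp: successively_conv_nth)
    fix j assume ij: "i < length p" "j < length p" "fst (p ! i) = fst (p ! j) \<or> snd (p ! i) = snd (p ! j)"
    then have "p ! i = p ! j" using inj p(1) by (metis inj_onD nth_mem subsetD)
    then show "i = j" using dist[OF p] ij by (simp add: nth_eq_iff_index_eq)
  qed
  ultimately show ?thesis using p(1) V_sub V_sup by blast
qed

text \<open>Every component inherits linearity from \<open>S\<close>. One with arcs is a simple path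
  by \<open>connected_linear_arcs_path\<close>; one without arcs is connected and so a single
  vertex.\<close>

lemma multipath_linear_arcs:
  assumes "pair_wf_digraph G" "S \<subseteq> parcs G" "finite S" "linear_arcs S"
  shows "multipath G \<lparr>pverts = pverts G, parcs = S\<rparr>" (is "multipath G ?H")
proof -
  interpret pair_wf_digraph G by fact
  have wf_H: "pair_wf_digraph ?H"
    using assms(2) by unfold_locales (auto dest: arc_fst_in_verts arc_snd_in_verts)
  have "Digraph_Component.spanning (with_proj ?H) (with_proj G)"
    using assms wf_H by (auto simp: Digraph_Component.spanning_def subgraph_def wf_digraph_wp_iff)
  moreover have "(\<exists>u. verts C = {u} \<and> arcs C = {}) \<or>
        (\<exists>p. simple_path ?H p \<and> arcs C = set p \<and> verts C = fst ` set p \<union> snd ` set p)"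
    if "connected_component_of_digraph ?H C" for C
  proof -
    have C: "subgraph C (with_proj ?H)" "Digraph_Component.connected C"
      using that unfolding connected_component_of_digraph_def pre_digraph.max_subgraph_def by auto
    then have wf: "wf_digraph C" and arcs: "arcs C \<subseteq> S" and proj: "tail C = fst" "head C = snd"
      by (auto simp: subgraph_def compatible_def)
    show ?thesis
    proof (cases "arcs C = {}")
      case True
      then have "arcs_ends C = {}" by (auto simp: arcs_ends_conv)
      moreover obtain u where "u \<in> verts C" using C(2) by (auto simp: connected_conv)
      moreover have "x = y" if "(x, y) \<in> rtrancl_on (verts C) ({}\<^sup>s)" for x y :: 'a
        using that by (auto dest!: rtrancl_on_rtranclI simp: symcl_def)
      ultimately have "verts C = {u}" using C(2) by (auto simp: connected_conv)
      then show ?thesis using True by blast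
    next
      case False
      have "finite (arcs C)" using arcs assms(3) by (rule finite_subset)
      moreover have "linear_arcs (arcs C)" using assms(4) arcs by (rule linear_arcs_subset)
      ultimately show ?thesis
        using connected_linear_arcs_path[OF wf proj C(2) _ _ False, of ?H] arcs by auto
    qed
  qed
  ultimately show ?thesis by (simp add: multipath_def)
qed

text \<open>The spanning condition fixes the vertices, so a multipath is determined by its arcs.
  Everything later argues with these conditions on arcs instead of components.\<close>

lemma multipath_complex_eq:
  assumes "pair_wf_digraph G"
  shows "multipath_complex G = {S. S \<subseteq> parcs G \<and> finite S \<and> S \<noteq> {} \<and> linear_arcs S}"
proof (intro equalityI subsetI)
  fix S assume "S \<in> multipath_complex G"
  then show "S \<in> {S. S \<subseteq> parcs G \<and> finite S \<and> S \<noteq> {} \<and> linear_arcs S}"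
    using linear_arcs_multipath[of G] unfolding multipath_complex_def
    by (force simp: multipath_def Digraph_Component.spanning_def subgraph_def)
next
  fix S assume "S \<in> {S. S \<subseteq> parcs G \<and> finite S \<and> S \<noteq> {} \<and> linear_arcs S}"
  then show "S \<in> multipath_complex G"
    using multipath_linear_arcs[OF assms, of S] unfolding multipath_complex_def
    by (auto intro!: exI[of _ "\<lparr>pverts = pverts G, parcs = S\<rparr>"])
qed

section \<open>Compatibility of single arcs with a linear set\<close>

text \<open>A new cycle through \<open>e\<close> would return from its target to its source inside
  \<open>S\<close>, so some arc of \<open>S\<close> would leave the target and some arc would enter
  the source. The last assumption excludes one of the two.\<close>

lemma linear_arcs_insert:
  assumes "linear_arcs S" "fst e \<notin> fst ` S" "snd e \<notin> snd ` S" "fst e \<noteq> snd e"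
    and "fst e \<notin> snd ` S \<or> snd e \<notin> fst ` S"
  shows "linear_arcs (insert e S)"
proof -
  obtain y x where e: "e = (y, x)" by fastforce
  have "(x, y) \<notin> S\<^sup>*"
  proof
    assume "(x, y) \<in> S\<^sup>*"
    then have "(x, y) \<in> S\<^sup>+" using assms(4) e by (auto simp: rtrancl_eq_or_trancl)
    then obtain z w where "(x, z) \<in> S" "(w, y) \<in> S" by (meson tranclD tranclD2)
    then show False using assms(5) e by force
  qed
  then show ?thesis using assms e by (auto simp: linear_arcs_def inj_on_def)
qed

lemma linear_arcsD:
  assumes "linear_arcs S" "e \<in> S" "f \<in> S" "fst e = fst f \<or> snd e = snd f"
  shows "e = f"
  using assms by (auto simp: linear_arcs_def dest: inj_onD)

lemma linear_arcs_no_2_cycle: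
  assumes "linear_arcs S" "(x, y) \<in> S"
  shows "(y, x) \<notin> S"
proof
  assume "(y, x) \<in> S"
  with assms(2) have "(x, x) \<in> S\<^sup>+" by (rule trancl.intros(2)[OF trancl.intros(1)])
  then show False using assms(1) by (simp add: linear_arcs_def acyclic_def)
qed

section \<open>Maps on geometric realizations\<close>

lemma topspace_realization [simp]: "topspace (realization K) = (\<Union>\<sigma>\<in>K. closed_simplex \<sigma>)"
proof -
  have "(\<Union>\<sigma>\<in>K. closed_simplex \<sigma>) \<inter> closed_simplex \<sigma> = closed_simplex \<sigma>" if "\<sigma> \<in> K" for \<sigma>
    using that by blast
  then have "openin (realization K) (\<Union>\<sigma>\<in>K. closed_simplex \<sigma>)"
    by (simp add: openin_realization)
  then show ?thesis by (auto simp: topspace_def openin_realization)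
qed

lemma closed_simplex_mono:
  assumes "finite \<tau>" "\<sigma> \<subseteq> \<tau>"
  shows "closed_simplex \<sigma> \<subseteq> closed_simplex \<tau>"
proof
  fix x assume x: "x \<in> closed_simplex \<sigma>"
  have "(\<Sum>a\<in>\<sigma>. x a) = (\<Sum>a\<in>\<tau>. x a)"
    using assms x by (intro sum.mono_neutral_left) (auto simp: closed_simplex_def)
  then show "x \<in> closed_simplex \<tau>" using x assms by (auto simp: closed_simplex_def)
qed

lemma closed_simplex_convex:
  assumes "x \<in> closed_simplex \<sigma>" "y \<in> closed_simplex \<sigma>" "0 \<le> u" "u \<le> 1"
  shows "(\<lambda>c. (1 - u) * x c + u * y c) \<in> closed_simplex \<sigma>"
  using assms by (auto simp: closed_simplex_def sum.distrib simp flip: sum_distrib_left)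

lemma vertex_point_in_closed_simplex:
  "finite \<sigma> \<Longrightarrow> a \<in> \<sigma> \<Longrightarrow> vertex_point a \<in> closed_simplex \<sigma>"
  by (auto simp: closed_simplex_def vertex_point_def)

text \<open>The simplex lives in the product space over all vertices, so compactness comes from
  Tychonoff: it is a closed slice of a box whose factors off \<open>\<sigma>\<close> are
  \<open>{0}\<close>.\<close>

lemma compact_space_closed_simplex:
  fixes \<sigma> :: "'b set"
  assumes "finite \<sigma>"
  shows "compact_space (top_of_set (closed_simplex \<sigma>))"
proof -
  let ?box = "PiE UNIV (\<lambda>a::'b. if a \<in> \<sigma> then {0..1::real} else {0})"
  have le_1: "x a \<le> 1" if "x \<in> closed_simplex \<sigma>" "a \<in> \<sigma>" for x a
    using that assms member_le_sum[of a \<sigma> x] by (auto simp: closed_simplex_def)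
  have eq: "closed_simplex \<sigma> = ?box \<inter> (\<lambda>x. \<Sum>a\<in>\<sigma>. x a) -` {1}"
    using le_1 by (fastforce simp: closed_simplex_def PiE_iff split: if_splits)
  have "compactin (product_topology (\<lambda>_. euclidean) UNIV) ?box"
    by (auto simp: compactin_PiE)
  then have "compact ?box"
    by (simp add: euclidean_product_topology)
  moreover have "continuous_on UNIV (\<lambda>x::'b \<Rightarrow> real. \<Sum>a\<in>\<sigma>. x a)"
    by (intro continuous_on_sum continuous_on_product_coordinates)
  then have "closed ((\<lambda>x::'b \<Rightarrow> real. \<Sum>a\<in>\<sigma>. x a) -` {1})"
    by (intro closed_vimage closed_singleton)
  ultimately have "compact (closed_simplex \<sigma>)"
    unfolding eq by (rule compact_Int_closed)
  then show ?thesis by (simp add: compact_space_subtopology compactin_euclidean_iff)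
qed

lemma Hausdorff_space_closed_simplex: "Hausdorff_space (top_of_set (closed_simplex \<sigma>))"
  by (intro Hausdorff_space_subtopology)
    (simp flip: euclidean_product_topology add: Hausdorff_space_product_topology)

text \<open>The weak topology makes the inclusion of each closed simplex continuous by its very
  definition.\<close>

lemma continuous_map_into_realization:
  assumes "\<sigma> \<in> K" "continuous_map Z (top_of_set (closed_simplex \<sigma>)) f"
  shows "continuous_map Z (realization K) f"
proof -
  have "continuous_map (top_of_set (closed_simplex \<sigma>)) (realization K) id"
    unfolding continuous_map_def using assms(1)
    by (auto simp: openin_realization Int_def conj_commute)
  from continuous_map_compose[OF assms(2) this] show ?thesis by simp
qed

text \<open>
  Multiplication with the locally compact space \<open>Z\<close> preserves the quotient map from the disjoint
  union of the simplices onto the realization.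
\<close>
lemma continuous_map_prod_realization:
  assumes Z: "locally_compact_space Z" "Hausdorff_space Z"
    and f: "\<And>\<sigma>. \<sigma> \<in> K \<Longrightarrow> continuous_map (prod_topology Z (top_of_set (closed_simplex \<sigma>))) Y f"
  shows "continuous_map (prod_topology Z (realization K)) Y f"
proof -
  let ?cs = "\<lambda>\<sigma>. top_of_set (closed_simplex \<sigma>)"
  let ?\<Sigma> = "sum_topology ?cs K"
  let ?q = "\<lambda>(z, p). (z, snd p)"
  have "quotient_map ?\<Sigma> (realization K) snd"
    unfolding quotient_map_def
  proof (intro conjI allI impI)
    show "snd ` topspace ?\<Sigma> = topspace (realization K)" by force
    fix U assume "U \<subseteq> topspace (realization K)"
    then show "openin ?\<Sigma> {x \<in> topspace ?\<Sigma>. snd x \<in> U} = openin (realization K) U"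
      by (auto simp: openin_sum_topology openin_realization Int_def conj_commute)
  qed
  then have q: "quotient_map (prod_topology Z ?\<Sigma>) (prod_topology Z (realization K)) ?q"
    using Z by (intro quotient_map_prod_right) auto
  \<comment> \<open>The summands are open in the disjoint union, so continuity may be tested on each
    of them, where assumption \<open>f\<close> applies.\<close>
  have "continuous_map (prod_topology Z ?\<Sigma>) Y (f \<circ> ?q)"
  proof (rule pasting_lemma[where I = K and T = "\<lambda>\<sigma>. topspace Z \<times> ({\<sigma>} \<times> closed_simplex \<sigma>)"
        and f = "\<lambda>_. f \<circ> ?q"])
    fix \<sigma> assume "\<sigma> \<in> K"
    have open_\<Sigma>: "openin ?\<Sigma> ({\<sigma>} \<times> U)" if "openin (?cs \<sigma>) U" for U
    proof -
      have "{x. (i, x) \<in> {\<sigma>} \<times> U} = (if i = \<sigma> then U else {})" for i by auto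
      moreover have "U \<subseteq> closed_simplex \<sigma>" using that openin_subset by fastforce
      ultimately show ?thesis using that \<open>\<sigma> \<in> K\<close> by (auto simp: openin_sum_topology)
    qed
    then show "openin (prod_topology Z ?\<Sigma>) (topspace Z \<times> ({\<sigma>} \<times> closed_simplex \<sigma>))"
      by (simp add: openin_prod_Times_iff)
    have "continuous_map (subtopology ?\<Sigma> ({\<sigma>} \<times> closed_simplex \<sigma>)) (?cs \<sigma>) snd"
      unfolding continuous_map_def
    proof (intro conjI allI impI)
      show "snd \<in> topspace (subtopology ?\<Sigma> ({\<sigma>} \<times> closed_simplex \<sigma>)) \<rightarrow> topspace (?cs \<sigma>)"
        by auto
      fix U assume U: "openin (?cs \<sigma>) U"
      then have "U \<subseteq> closed_simplex \<sigma>" using openin_subset by fastforce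
      then have "{x \<in> topspace (subtopology ?\<Sigma> ({\<sigma>} \<times> closed_simplex \<sigma>)). snd x \<in> U}
          = ({\<sigma>} \<times> U) \<inter> ({\<sigma>} \<times> closed_simplex \<sigma>)"
        using \<open>\<sigma> \<in> K\<close> by auto
      then show "openin (subtopology ?\<Sigma> ({\<sigma>} \<times> closed_simplex \<sigma>))
          {x \<in> topspace (subtopology ?\<Sigma> ({\<sigma>} \<times> closed_simplex \<sigma>)). snd x \<in> U}"
        using open_\<Sigma>[OF U] by (simp only: openin_subtopology_Int)
    qed
    then have "continuous_map (prod_topology Z (subtopology ?\<Sigma> ({\<sigma>} \<times> closed_simplex \<sigma>)))
        (prod_topology Z (?cs \<sigma>)) ?q"
      by (auto simp: continuous_map_paired case_prod_unfold continuous_map_fst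
          intro!: continuous_map_compose[OF continuous_map_snd, unfolded o_def])
    from continuous_map_compose[OF this f[OF \<open>\<sigma> \<in> K\<close>]]
    show "continuous_map (subtopology (prod_topology Z ?\<Sigma>) (topspace Z \<times> ({\<sigma>} \<times> closed_simplex \<sigma>)))
        Y (f \<circ> ?q)"
      by (metis prod_topology_subtopology(2) subtopology_Times subtopology_topspace)
  qed auto
  then show ?thesis using q by (simp add: continuous_compose_quotient_map_eq)
qed

lemma continuous_map_realization_prod:
  assumes "locally_compact_space Z" "Hausdorff_space Z"
    and f: "\<And>\<sigma>. \<sigma> \<in> K \<Longrightarrow> continuous_map (prod_topology (top_of_set (closed_simplex \<sigma>)) Z) Y f"
  shows "continuous_map (prod_topology (realization K) Z) Y f"
proof -
  let ?swap = "\<lambda>(x, y). (y, x)"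
  have "continuous_map (prod_topology Z (top_of_set (closed_simplex \<sigma>))) Y (f \<circ> ?swap)"
    if "\<sigma> \<in> K" for \<sigma>
    using continuous_map_compose[OF _ f[OF that], of _ ?swap]
    by (simp add: case_prod_unfold continuous_map_paired continuous_map_fst continuous_map_snd)
  then have "continuous_map (prod_topology Z (realization K)) Y (f \<circ> ?swap)"
    by (intro continuous_map_prod_realization assms)
  moreover have "continuous_map (prod_topology (realization K) Z) (prod_topology Z (realization K)) ?swap"
    by (simp add: case_prod_unfold continuous_map_paired continuous_map_fst continuous_map_snd)
  ultimately have "continuous_map (prod_topology (realization K) Z) Y (f \<circ> ?swap \<circ> ?swap)"
    by (metis continuous_map_compose)
  then show ?thesis by (simp add: o_def case_prod_unfold)
qed

lemma continuous_map_realization: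
  assumes "\<And>\<sigma>. \<sigma> \<in> K \<Longrightarrow> continuous_map (top_of_set (closed_simplex \<sigma>)) Y f"
  shows "continuous_map (realization K) Y f"
  unfolding continuous_map_def
proof (intro conjI allI impI)
  show "f \<in> topspace (realization K) \<rightarrow> topspace Y"
    using assms by (force simp: continuous_map_def)
  fix U assume U: "openin Y U"
  have "{x \<in> topspace (realization K). f x \<in> U} \<inter> closed_simplex \<sigma> = {x \<in> closed_simplex \<sigma>. f x \<in> U}"
    if "\<sigma> \<in> K" for \<sigma>
    using that by auto
  then show "openin (realization K) {x \<in> topspace (realization K). f x \<in> U}"
    using assms U by (auto simp: openin_realization continuous_map_def)
qed

text \<open>A generalization of contiguity of simplicial maps.\<close>
lemma homotopic_with_straight_line:
  fixes K :: "'b set set"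
  assumes f: "\<And>\<sigma>. \<sigma> \<in> K \<Longrightarrow> continuous_on (closed_simplex \<sigma>) f"
    and carrier: "\<And>\<sigma>. \<sigma> \<in> K \<Longrightarrow>
      \<exists>\<tau>\<in>K. closed_simplex \<sigma> \<subseteq> closed_simplex \<tau> \<and> f ` closed_simplex \<sigma> \<subseteq> closed_simplex \<tau>"
  shows "homotopic_with (\<lambda>_. True) (realization K) (realization K) f id"
proof -
  let ?I = "top_of_set {0..1::real}"
  define h where "h = (\<lambda>(u::real, x) c. (1 - u) * f x c + u * x c)"
  \<comment> \<open>Local compactness of the interval allows continuity to be tested over each
    closed simplex separately.\<close>
  have "continuous_map (prod_topology ?I (realization K)) (realization K) h"
  proof (rule continuous_map_prod_realization)
    show "locally_compact_space ?I"
      by (simp add: compact_imp_locally_compact_space compact_space_subtopology compactin_euclidean_iff)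
    show "Hausdorff_space ?I" by (simp add: Hausdorff_space_subtopology)
    fix \<sigma> assume "\<sigma> \<in> K"
    \<comment> \<open>A single simplex \<open>\<tau>\<close> contains both \<open>x\<close> and
      \<open>f x\<close>, and by convexity the segment between them.\<close>
    then obtain \<tau> where \<tau>: "\<tau> \<in> K" "closed_simplex \<sigma> \<subseteq> closed_simplex \<tau>"
      "f ` closed_simplex \<sigma> \<subseteq> closed_simplex \<tau>" using carrier by meson
    let ?P = "{0..1} \<times> closed_simplex \<sigma>"
    have "continuous_on ?P snd" by (intro continuous_on_snd continuous_on_id)
    then have x: "continuous_on ?P (\<lambda>p. snd p c)" for c
      by (rule continuous_on_product_then_coordinatewise)
    have "continuous_on ?P (\<lambda>p. f (snd p))"
      by (rule continuous_on_compose2[OF f[OF \<open>\<sigma> \<in> K\<close>]])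
        (auto intro: continuous_on_snd continuous_on_id)
    then have fx: "continuous_on ?P (\<lambda>p. f (snd p) c)" for c
      by (rule continuous_on_product_then_coordinatewise)
    have "continuous_on ?P h"
      unfolding h_def case_prod_unfold
      by (intro continuous_on_coordinatewise_then_product continuous_intros x fx)
    moreover have "h \<in> ?P \<rightarrow> closed_simplex \<tau>"
      using \<tau> by (auto simp: h_def intro!: closed_simplex_convex)
    ultimately have "continuous_map (prod_topology ?I (top_of_set (closed_simplex \<sigma>)))
        (top_of_set (closed_simplex \<tau>)) h"
      by (simp add: continuous_map_in_subtopology)
    then show "continuous_map (prod_topology ?I (top_of_set (closed_simplex \<sigma>))) (realization K) h"
      using \<tau>(1) continuous_map_into_realization by blast
  qed
  moreover have "h (0, x) = f x" "h (1, x) = id x" for x by (auto simp: h_def)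
  ultimately show ?thesis unfolding homotopic_with_def by (intro exI[of _ h]) auto
qed

text \<open>The map \<open>f\<close> is a retraction onto the subcomplex and is homotopic to the
  identity along straight lines, so it is a homotopy inverse of the inclusion.\<close>

lemma homotopy_equivalence_map_inclusion:
  fixes f :: "('b \<Rightarrow> real) \<Rightarrow> 'b \<Rightarrow> real"
  assumes "L \<subseteq> X"
    and f: "\<And>\<sigma>. \<sigma> \<in> X \<Longrightarrow> continuous_on (closed_simplex \<sigma>) f"
    and retract: "\<And>\<sigma>. \<sigma> \<in> X \<Longrightarrow> \<exists>\<tau>\<in>L. f ` closed_simplex \<sigma> \<subseteq> closed_simplex \<tau>"
    and fixed: "\<And>\<sigma> x. \<sigma> \<in> L \<Longrightarrow> x \<in> closed_simplex \<sigma> \<Longrightarrow> f x = x"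
    and carrier: "\<And>\<sigma>. \<sigma> \<in> X \<Longrightarrow>
      \<exists>\<tau>\<in>X. closed_simplex \<sigma> \<subseteq> closed_simplex \<tau> \<and> f ` closed_simplex \<sigma> \<subseteq> closed_simplex \<tau>"
  shows "homotopy_equivalence_map (realization L) (realization X) id"
  unfolding homotopy_equivalence_map_def
proof (intro conjI exI[of _ f])
  show incl: "continuous_map (realization L) (realization X) id"
    by (rule continuous_map_realization)
      (use \<open>L \<subseteq> X\<close> in \<open>auto intro!: continuous_map_into_realization\<close>)
  show retr: "continuous_map (realization X) (realization L) f"
  proof (rule continuous_map_realization)
    fix \<sigma> assume "\<sigma> \<in> X"
    then obtain \<tau> where \<tau>: "\<tau> \<in> L" "f ` closed_simplex \<sigma> \<subseteq> closed_simplex \<tau>" using retract by meson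
    then have "continuous_map (top_of_set (closed_simplex \<sigma>)) (top_of_set (closed_simplex \<tau>)) f"
      using f[OF \<open>\<sigma> \<in> X\<close>] by (auto simp: continuous_map_in_subtopology)
    then show "continuous_map (top_of_set (closed_simplex \<sigma>)) (realization L) f"
      using \<tau>(1) continuous_map_into_realization by blast
  qed
  show "homotopic_with (\<lambda>_. True) (realization L) (realization L) (f \<circ> id) id"
    using continuous_map_compose[OF incl retr] fixed by (intro homotopic_with_equal) auto
  show "homotopic_with (\<lambda>_. True) (realization X) (realization X) (id \<circ> f) id"
    using homotopic_with_straight_line[OF f carrier] by simp
qed

text \<open>
  In the language of strong collapses: every vertex in \<open>A\<close> is dominated by \<open>d\<close>, and \<open>L\<close> is what
  remains of \<open>X\<close> when the vertices in \<open>A\<close> are deleted.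
\<close>
lemma homotopy_equivalence_map_dominated:
  fixes X L :: "'b set set" and A :: "'b set" and d :: 'b
  assumes "L \<subseteq> X" and fin: "\<And>\<sigma>. \<sigma> \<in> X \<Longrightarrow> finite \<sigma>" and "{} \<notin> X" and A: "finite A" "d \<notin> A"
    and disj: "\<And>\<sigma>. \<sigma> \<in> L \<Longrightarrow> \<sigma> \<inter> A = {}"
    and delete: "\<And>\<sigma>. \<sigma> \<in> X \<Longrightarrow> \<sigma> - A \<noteq> {} \<Longrightarrow> \<sigma> - A \<in> L"
    and dominated: "\<And>\<sigma>. \<sigma> \<in> X \<Longrightarrow> \<sigma> \<inter> A \<noteq> {} \<Longrightarrow> insert d \<sigma> \<in> X"
  shows "homotopy_equivalence_map (realization L) (realization X) id"
proof -
  \<comment> \<open>The simplicial map sending each vertex of \<open>A\<close> to \<open>d\<close>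
    and fixing all others, in barycentric coordinates: the mass on \<open>A\<close> is moved to
    \<open>d\<close>.\<close>
  define r where "r x = (\<lambda>c. if c = d then x d + (\<Sum>a\<in>A. x a) else if c \<in> A then 0 else x c)"
    for x :: "'b \<Rightarrow> real"
  have r_id: "r x = x" if "x \<in> closed_simplex \<sigma>" "\<sigma> \<inter> A = {}" for x \<sigma>
  proof -
    have "x a = 0" if "a \<in> A" for a
      using that \<open>x \<in> _\<close> \<open>\<sigma> \<inter> A = {}\<close> by (auto simp: closed_simplex_def)
    then show ?thesis by (auto simp: r_def)
  qed
  have r_simplex: "r x \<in> closed_simplex (insert d \<sigma> - A)" if \<sigma>: "finite \<sigma>" "x \<in> closed_simplex \<sigma>" for x \<sigma>
  proof -
    have x: "0 \<le> x a" "a \<notin> \<sigma> \<Longrightarrow> x a = 0" for a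
      using \<sigma> by (auto simp: closed_simplex_def)
    \<comment> \<open>Total mass is conserved: the coordinate at \<open>d\<close> absorbs exactly
      what the vertices of \<open>A\<close> lose.\<close>
    have "(\<Sum>c\<in>insert d \<sigma> - A. r x c) = r x d + (\<Sum>c\<in>\<sigma> - insert d A. r x c)"
      using A \<sigma> by (subst sum.remove[of _ d]) (auto intro: arg_cong2[of _ _ _ _ sum])
    also have "(\<Sum>c\<in>\<sigma> - insert d A. r x c) = (\<Sum>c\<in>\<sigma> - insert d A. x c)"
      by (rule sum.cong) (auto simp: r_def)
    also have "r x d = (\<Sum>c\<in>insert d A. x c)"
      using A by (simp add: r_def)
    also have "\<dots> + (\<Sum>c\<in>\<sigma> - insert d A. x c) = (\<Sum>c\<in>insert d A \<union> \<sigma>. x c)"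
      using A \<sigma> by (subst sum.union_disjoint[symmetric]) (auto intro: arg_cong2[of _ _ _ _ sum])
    also have "\<dots> = (\<Sum>c\<in>\<sigma>. x c)"
      using A \<sigma> x by (intro sum.mono_neutral_right) auto
    also have "\<dots> = 1" using \<sigma> by (simp add: closed_simplex_def)
    finally show ?thesis
      using x A(2) by (auto simp: closed_simplex_def r_def intro!: add_nonneg_nonneg sum_nonneg)
  qed
  have r_cont: "continuous_on S r" for S
  proof -
    have "continuous_on S (\<lambda>x::'b \<Rightarrow> real. x c)" for c
      by (rule continuous_on_product_then_coordinatewise[OF continuous_on_id])
    then have "continuous_on S (\<lambda>x. r x c)" for c
      unfolding r_def by (cases "c = d"; cases "c \<in> A") (auto intro!: continuous_intros)
    then show ?thesis by (rule continuous_on_coordinatewise_then_product)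
  qed
  \<comment> \<open>As \<open>d\<close> is not in \<open>A\<close>, it survives the deletion, so the
    remainder is nonempty.\<close>
  have in_L: "insert d \<sigma> - A \<in> L" if "\<sigma> \<in> X" "\<sigma> \<inter> A \<noteq> {}" for \<sigma>
    using delete[OF dominated[OF that]] A(2) by blast
  show ?thesis
  proof (rule homotopy_equivalence_map_inclusion[where f = r])
    show "L \<subseteq> X" by fact
    fix \<sigma> assume "\<sigma> \<in> X"
    note fin_\<sigma> = fin[OF this]
    show "continuous_on (closed_simplex \<sigma>) r" by (rule r_cont)
    show "\<exists>\<tau>\<in>L. r ` closed_simplex \<sigma> \<subseteq> closed_simplex \<tau>"
    proof (cases "\<sigma> \<inter> A = {}")
      case True
      \<comment> \<open>Here \<open>r_simplex\<close> would only give
        \<open>insert d \<sigma>\<close>, which need not be a simplex of \<open>X\<close>; instead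
        \<open>r\<close> is the identity on \<open>\<sigma>\<close>.\<close>
      then have *: "r ` closed_simplex \<sigma> \<subseteq> closed_simplex \<sigma>" using r_id by auto
      have "\<sigma> \<in> L" using delete[OF \<open>\<sigma> \<in> X\<close>] True \<open>\<sigma> \<in> X\<close> \<open>{} \<notin> X\<close> by (auto simp: Diff_triv)
      then show ?thesis using * by blast
    next
      case False
      then show ?thesis using in_L[OF \<open>\<sigma> \<in> X\<close>] r_simplex[OF fin_\<sigma>] by blast
    qed
    show "\<exists>\<tau>\<in>X. closed_simplex \<sigma> \<subseteq> closed_simplex \<tau> \<and> r ` closed_simplex \<sigma> \<subseteq> closed_simplex \<tau>"
    proof (cases "\<sigma> \<inter> A = {}")
      case True
      then show ?thesis using r_id \<open>\<sigma> \<in> X\<close> by (intro bexI[of _ \<sigma>]) auto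
    next
      case False
      have "closed_simplex (insert d \<sigma> - A) \<subseteq> closed_simplex (insert d \<sigma>)"
        using fin_\<sigma> by (intro closed_simplex_mono) auto
      moreover have "closed_simplex \<sigma> \<subseteq> closed_simplex (insert d \<sigma>)"
        using fin_\<sigma> by (intro closed_simplex_mono) auto
      ultimately show ?thesis
        using dominated[OF \<open>\<sigma> \<in> X\<close> False] r_simplex[OF fin_\<sigma>] by blast
    qed
  next
    fix \<sigma> x assume "\<sigma> \<in> L" "x \<in> closed_simplex \<sigma>"
    then show "r x = x" using r_id disj by blast
  qed
qed

section \<open>Suspensions as joins with two points\<close>

lemma simplicial_join_two_points:
  "\<sigma> \<in> simplicial_join {{a}, {b}} K \<longleftrightarrow>
    \<sigma> \<noteq> {} \<and> (\<exists>\<tau>. (\<tau> = {} \<or> \<tau> \<in> K) \<and> (\<sigma> = \<tau> \<or> \<sigma> = insert a \<tau> \<or> \<sigma> = insert b \<tau>))"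
  (is "?l \<longleftrightarrow> ?r")
proof
  assume ?l
  then obtain \<rho> \<tau> where "\<sigma> = \<rho> \<union> \<tau>" "\<rho> = {} \<or> \<rho> = {a} \<or> \<rho> = {b}" "\<tau> = {} \<or> \<tau> \<in> K" "\<sigma> \<noteq> {}"
    unfolding simplicial_join_def by auto
  then show ?r by (intro conjI exI[of _ \<tau>]) auto
next
  assume ?r
  then obtain \<rho> \<tau> where "\<sigma> = \<rho> \<union> \<tau>" "\<rho> \<in> insert {} {{a}, {b}}" "\<tau> \<in> insert {} K" "\<sigma> \<noteq> {}"
    by (metis insertCI insert_is_Un sup_bot_left)
  then show ?l unfolding simplicial_join_def by blast
qed

lemma susp_proj_in_carrier: "x \<in> S \<Longrightarrow> susp_proj (x, s) \<in> susp_carrier S"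
  by (auto simp: susp_proj_def susp_carrier_def)

lemma topspace_suspension [simp]: "topspace (suspension X) = susp_carrier (topspace X)"
proof -
  have "{p \<in> topspace X \<times> {-1..1}. susp_proj p \<in> susp_carrier (topspace X)} =
      topspace (prod_topology X (top_of_set {-1..1}))"
    by (auto simp: susp_proj_in_carrier)
  then have "openin (suspension X) (susp_carrier (topspace X))"
    unfolding openin_suspension by (metis openin_topspace subset_refl)
  then show ?thesis by (auto simp: topspace_def openin_suspension)
qed

text \<open>Used to test maps out of the suspension on the cylinder, of which it is a
  quotient.\<close>

lemma openin_suspension_preimage:
  "openin (suspension X) {z \<in> susp_carrier (topspace X). f z \<in> U} \<longleftrightarrow>
    openin (prod_topology X (top_of_set {-1..1})) {p \<in> topspace X \<times> {-1..1}. f (susp_proj p) \<in> U}"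
proof -
  have "{p \<in> topspace X \<times> {-1..1}. susp_proj p \<in> {z \<in> susp_carrier (topspace X). f z \<in> U}} =
      {p \<in> topspace X \<times> {-1..1}. f (susp_proj p) \<in> U}"
    by (auto simp: susp_proj_in_carrier)
  then show ?thesis unfolding openin_suspension by auto
qed

section \<open>Cones over simplices\<close>

text \<open>Describes either half of \<open>susp_to_join\<close>: \<open>u\<close> runs from the
  apex \<open>e\<close> at 0 to the base point \<open>x\<close> at 1.\<close>

definition cone_map :: "'b \<Rightarrow> ('b \<Rightarrow> real) \<times> real \<Rightarrow> 'b \<Rightarrow> real" where
  "cone_map e = (\<lambda>(x, u) c. (1 - u) * vertex_point e c + u * x c)"

text \<open>Both poles correspond to \<open>u = 0\<close> and the equator to \<open>u = 1\<close>;
  hence the height is \<open>u - 1\<close> on the half of \<open>a\<close>, but \<open>1 - u\<close>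
  on that of \<open>b\<close>.\<close>

lemma susp_to_join_susp_proj:
  assumes "u \<in> {0..1}"
  shows "susp_to_join a b (susp_proj (x, u - 1)) = cone_map a (x, u)"
    and "susp_to_join a b (susp_proj (x, 1 - u)) = cone_map b (x, u)"
  using assms by (auto simp: susp_proj_def cone_map_def)

lemma continuous_on_cone_map: "continuous_on S (cone_map e)"
proof -
  have fst: "continuous_on S (\<lambda>p. fst p c)" for c
    by (rule continuous_on_product_then_coordinatewise[OF continuous_on_fst[OF continuous_on_id]])
  show ?thesis
    unfolding cone_map_def case_prod_unfold
    by (intro continuous_on_coordinatewise_then_product continuous_intros fst)
qed

lemma cone_map_in_closed_simplex:
  assumes "finite \<sigma>" "x \<in> closed_simplex \<sigma>" "u \<in> {0..1}"
  shows "cone_map e (x, u) \<in> closed_simplex (insert e \<sigma>)"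
  unfolding cone_map_def using assms closed_simplex_mono[of "insert e \<sigma>" \<sigma>]
  by (auto intro!: closed_simplex_convex vertex_point_in_closed_simplex)

text \<open>For surjectivity, the parameter \<open>u\<close> of a point is its mass away from the
  apex, and the base point is the rest rescaled to mass 1.\<close>

lemma cone_map_image:
  assumes "finite \<sigma>" "\<sigma> \<noteq> {}" "e \<notin> \<sigma>"
  shows "cone_map e ` (closed_simplex \<sigma> \<times> {0..1}) = closed_simplex (insert e \<sigma>)"
proof (intro equalityI subsetI)
  fix y assume "y \<in> cone_map e ` (closed_simplex \<sigma> \<times> {0..1})"
  then show "y \<in> closed_simplex (insert e \<sigma>)"
    using assms(1) cone_map_in_closed_simplex by force
next
  fix y assume "y \<in> closed_simplex (insert e \<sigma>)"
  then have y: "\<And>c. 0 \<le> y c" "\<And>c. c \<notin> insert e \<sigma> \<Longrightarrow> y c = 0" "y e + (\<Sum>c\<in>\<sigma>. y c) = 1"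
    using assms by (auto simp: closed_simplex_def)
  define u where "u = (\<Sum>c\<in>\<sigma>. y c)"
  have u: "0 \<le> u" "u \<le> 1" "y e = 1 - u"
    using y(1)[of e] y(3) sum_nonneg[of \<sigma> y, OF y(1)] unfolding u_def by linarith+
  show "y \<in> cone_map e ` (closed_simplex \<sigma> \<times> {0..1})"
  proof (cases "u = 0")
    case True
    then have "y c = 0" if "c \<in> \<sigma>" for c
      using that assms(1) y(1) by (auto simp: u_def sum_nonneg_eq_0_iff)
    then have "y c = vertex_point e c" for c
      using y(2) u(3) True by (auto simp: vertex_point_def)
    \<comment> \<open>At the apex the base point is arbitrary; nonemptiness of
      \<open>\<sigma>\<close> supplies one.\<close>
    moreover obtain a where "a \<in> \<sigma>" using assms(2) by blast
    ultimately have "y = cone_map e (vertex_point a, 0)" "vertex_point a \<in> closed_simplex \<sigma>"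
      using assms(1) by (auto simp: cone_map_def intro: vertex_point_in_closed_simplex)
    then show ?thesis by force
  next
    case False
    define x where "x c = (if c = e then 0 else y c / u)" for c
    have "(\<Sum>c\<in>\<sigma>. x c) = (\<Sum>c\<in>\<sigma>. y c / u)"
      using assms(3) by (intro sum.cong) (auto simp: x_def)
    then have "(\<Sum>c\<in>\<sigma>. x c) = 1"
      using False by (simp add: u_def flip: sum_divide_distrib)
    then have "x \<in> closed_simplex \<sigma>"
      using y u by (auto simp: closed_simplex_def x_def)
    moreover have "y = cone_map e (x, u)"
      using False u(3) by (auto simp: cone_map_def x_def vertex_point_def)
    ultimately show ?thesis using u by force
  qed
qed

text \<open>A continuous surjection from a compact space onto a Hausdorff space is a quotient
  map.\<close>

lemma quotient_map_cone_map:
  assumes "finite \<sigma>" "\<sigma> \<noteq> {}" "e \<notin> \<sigma>"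
  shows "quotient_map (prod_topology (top_of_set (closed_simplex \<sigma>)) (top_of_set {0..1}))
           (top_of_set (closed_simplex (insert e \<sigma>))) (cone_map e)"
proof (rule T1_Spaces.continuous_imp_quotient_map)
  show "compact_space (prod_topology (top_of_set (closed_simplex \<sigma>)) (top_of_set {0..1::real}))"
    using compact_space_closed_simplex[OF assms(1)]
    by (simp add: compact_space_prod_topology compact_space_subtopology del: prod_topology_subtopology_eu)
  show "Hausdorff_space (top_of_set (closed_simplex (insert e \<sigma>)))"
    by (rule Hausdorff_space_closed_simplex)
  show "continuous_map (prod_topology (top_of_set (closed_simplex \<sigma>)) (top_of_set {0..1}))
      (top_of_set (closed_simplex (insert e \<sigma>))) (cone_map e)"
    using cone_map_image[OF assms] by (auto simp: continuous_map_in_subtopology continuous_on_cone_map)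
  show "cone_map e ` topspace (prod_topology (top_of_set (closed_simplex \<sigma>)) (top_of_set {0..1})) =
      topspace (top_of_set (closed_simplex (insert e \<sigma>)))"
    using cone_map_image[OF assms] by simp
qed

section \<open>The homeomorphism from the suspension to the join with two points\<close>

context
  fixes K :: "'b set set" and a b :: 'b
  assumes K: "\<And>\<sigma>. \<sigma> \<in> K \<Longrightarrow> finite \<sigma> \<and> \<sigma> \<noteq> {}"
    and a: "\<And>\<sigma>. \<sigma> \<in> K \<Longrightarrow> a \<notin> \<sigma>" and b: "\<And>\<sigma>. \<sigma> \<in> K \<Longrightarrow> b \<notin> \<sigma>" and ab: "a \<noteq> b"
begin

text \<open>Since the interval is locally compact, one simplex at a time suffices. Over it the map
  is pasted from two cone maps along height 0.\<close>

lemma continuous_map_susp_to_join_proj: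
  "continuous_map (prod_topology (realization K) (top_of_set {-1..1}))
     (realization (simplicial_join {{a}, {b}} K)) (susp_to_join a b \<circ> susp_proj)"
proof (rule continuous_map_realization_prod)
  let ?J = "simplicial_join {{a}, {b}} K"
  show "locally_compact_space (top_of_set {-1..1::real})"
    by (simp add: compact_imp_locally_compact_space compact_space_subtopology)
  show "Hausdorff_space (top_of_set {-1..1::real})" by (simp add: Hausdorff_space_subtopology)
  fix \<sigma> assume \<sigma>: "\<sigma> \<in> K"
  let ?P = "prod_topology (top_of_set (closed_simplex \<sigma>)) (top_of_set {-1..1::real})"
  let ?F = "susp_to_join a b \<circ> susp_proj"
  \<comment> \<open>One half of the cylinder: \<open>q\<close> cuts it out, \<open>e\<close> is its
    pole and \<open>k\<close> turns the height into the cone parameter.\<close>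
  have cone: "continuous_map (subtopology ?P {p \<in> topspace ?P. q p}) (realization ?J) ?F"
    if e: "insert e \<sigma> \<in> ?J" and k: "continuous_on UNIV k"
      and q: "\<And>x s. s \<in> {-1..1} \<Longrightarrow> q (x, s) \<Longrightarrow> k s \<in> {0..1} \<and> ?F (x, s) = cone_map e (x, k s)"
    for e k q
  proof -
    let ?S = "{p \<in> closed_simplex \<sigma> \<times> {-1..1}. q p}"
    have "continuous_on ?S (\<lambda>p. cone_map e (fst p, k (snd p)))"
      by (intro continuous_on_compose2[OF continuous_on_cone_map[of UNIV]] continuous_on_Pair
          continuous_on_compose2[OF k] continuous_on_fst continuous_on_snd continuous_on_id) auto
    then have "continuous_on ?S ?F"
      by (rule continuous_on_eq) (use q in force)
    moreover have "?F p \<in> closed_simplex (insert e \<sigma>)" if "p \<in> ?S" for p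
      using that q[of "snd p" "fst p"] cone_map_in_closed_simplex[of \<sigma>] K[OF \<sigma>] by auto
    moreover have "subtopology ?P {p \<in> topspace ?P. q p} = top_of_set ?S"
      by (simp add: subtopology_subtopology) (intro arg_cong[where f = "subtopology euclidean"], auto)
    ultimately have "continuous_map (subtopology ?P {p \<in> topspace ?P. q p})
        (top_of_set (closed_simplex (insert e \<sigma>))) ?F"
      by (auto simp: continuous_map_in_subtopology)
    then show ?thesis using e by (intro continuous_map_into_realization)
  qed
  \<comment> \<open>The two branches agree; the case distinction only brings the map into the form
    required for pasting along closed halves.\<close>
  have "continuous_map ?P (realization ?J) (\<lambda>p. if snd p \<le> 0 then ?F p else ?F p)"
  proof (rule continuous_map_cases_le)
    show "continuous_map ?P euclideanreal snd"
      by (rule continuous_map_into_fulltopology[OF continuous_map_snd])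
    show "continuous_map (subtopology ?P {p \<in> topspace ?P. snd p \<le> 0}) (realization ?J) ?F"
    proof (rule cone[where e = a and k = "\<lambda>s. s + 1"])
      show "insert a \<sigma> \<in> ?J" using \<sigma> by (auto simp: simplicial_join_two_points)
      show "s + 1 \<in> {0..1} \<and> ?F (x, s) = cone_map a (x, s + 1)"
        if "s \<in> {-1..1}" "snd (x, s) \<le> 0" for x s
        using susp_to_join_susp_proj(1)[of "s + 1" a b x] that by auto
    qed (intro continuous_intros)
    show "continuous_map (subtopology ?P {p \<in> topspace ?P. 0 \<le> snd p}) (realization ?J) ?F"
    proof (rule cone[where e = b and k = "\<lambda>s. 1 - s"])
      show "insert b \<sigma> \<in> ?J" using \<sigma> by (auto simp: simplicial_join_two_points)
      show "1 - s \<in> {0..1} \<and> ?F (x, s) = cone_map b (x, 1 - s)"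
        if "s \<in> {-1..1}" "0 \<le> snd (x, s)" for x s
        using susp_to_join_susp_proj(2)[of "1 - s" a b x] that by auto
    qed (intro continuous_intros)
  qed auto
  then show "continuous_map ?P (realization ?J) ?F" by (simp add: o_def)
qed

lemma continuous_map_susp_to_join:
  "continuous_map (suspension (realization K)) (realization (simplicial_join {{a}, {b}} K))
     (susp_to_join a b)"
  unfolding continuous_map_def
proof (intro conjI allI impI)
  let ?J = "simplicial_join {{a}, {b}} K"
  have "susp_to_join a b (susp_proj p) \<in> topspace (realization ?J)"
    if "p \<in> topspace (realization K) \<times> {-1..1}" for p
    using continuous_map_susp_to_join_proj that unfolding continuous_map_def by force
  moreover have "Band x s = susp_proj (x, s)" if "-1 < s" "s < 1" for x :: "'b \<Rightarrow> real" and s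
    using that by (simp add: susp_proj_def)
  moreover have "{a} \<in> ?J" "{b} \<in> ?J" by (auto simp: simplicial_join_two_points)
  then have "vertex_point a \<in> topspace (realization ?J)" "vertex_point b \<in> topspace (realization ?J)"
    using vertex_point_in_closed_simplex[of "{a}" a] vertex_point_in_closed_simplex[of "{b}" b] by auto
  ultimately show "susp_to_join a b \<in> topspace (suspension (realization K)) \<rightarrow> topspace (realization ?J)"
    by (force simp: susp_carrier_def simp del: topspace_realization)
  fix U assume "openin (realization ?J) U"
  then show "openin (suspension (realization K))
      {z \<in> topspace (suspension (realization K)). susp_to_join a b z \<in> U}"
    using continuous_map_susp_to_join_proj
    unfolding continuous_map_def topspace_suspension openin_suspension_preimage by auto
qed

text \<open>Reduces questions about the join to the poles and to the cones with apex
  \<open>a\<close> or \<open>b\<close> over simplices of \<open>K\<close>, which need not be listed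
  face by face.\<close>

lemma join_simplex_cases:
  assumes "\<rho> \<in> simplicial_join {{a}, {b}} K"
  obtains "\<rho> = {a}" | "\<rho> = {b}" | \<tau> where "\<tau> \<in> K" "\<rho> \<subseteq> insert a \<tau>" | \<tau> where "\<tau> \<in> K" "\<rho> \<subseteq> insert b \<tau>"
proof -
  from assms obtain \<tau> where \<tau>: "\<tau> = {} \<or> \<tau> \<in> K" "\<rho> = \<tau> \<or> \<rho> = insert a \<tau> \<or> \<rho> = insert b \<tau>" "\<rho> \<noteq> {}"
    unfolding simplicial_join_two_points by blast
  show thesis
  proof (cases "\<tau> = {}")
    case True
    then show ?thesis using \<tau> that(1,2) by auto
  next
    case False
    then show ?thesis using \<tau> that(3,4) by auto
  qed
qed

text \<open>The cone carries the quotient topology from the cylinder over \<open>\<tau>\<close>.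
  There the preimage of \<open>U\<close> is pulled back from the open set in \<open>P\<close> along
  the reparametrization \<open>k\<close> of the height.\<close>

lemma openin_cone:
  assumes P: "openin (prod_topology (realization K) (top_of_set {-1..1}))
      {p \<in> topspace (realization K) \<times> {-1..1}. susp_to_join a b (susp_proj p) \<in> U}"
    and \<tau>: "\<tau> \<in> K" and e: "e \<notin> \<tau>"
    and k: "continuous_on {0..1} k" "\<And>u. u \<in> {0..1} \<Longrightarrow> k u \<in> {-1..1}"
      "\<And>x u. u \<in> {0..1} \<Longrightarrow> susp_to_join a b (susp_proj (x, k u)) = cone_map e (x, u)"
  shows "openin (top_of_set (closed_simplex (insert e \<tau>))) (closed_simplex (insert e \<tau>) \<inter> U)"
proof -
  let ?C = "prod_topology (top_of_set (closed_simplex \<tau>)) (top_of_set {0..1::real})"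
  let ?k = "\<lambda>p. (fst p, k (snd p))"
  have "continuous_map ?C (realization K) fst"
    by (intro continuous_map_into_realization[OF \<tau>] continuous_map_fst)
  moreover have "continuous_map (top_of_set {0..1}) (top_of_set {-1..1}) k"
    using k by (auto simp: continuous_map_in_subtopology)
  then have "continuous_map ?C (top_of_set {-1..1}) (k \<circ> snd)"
    by (rule continuous_map_compose[OF continuous_map_snd])
  ultimately have "continuous_map ?C (prod_topology (realization K) (top_of_set {-1..1})) ?k"
    by (simp add: continuous_map_paired o_def del: prod_topology_subtopology_eu)
  from openin_continuous_map_preimage[OF this P]
  have "openin ?C {p \<in> closed_simplex \<tau> \<times> {0..1}.
      ?k p \<in> {p \<in> topspace (realization K) \<times> {-1..1}. susp_to_join a b (susp_proj p) \<in> U}}"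
    by simp
  also have "{p \<in> closed_simplex \<tau> \<times> {0..1}.
      ?k p \<in> {p \<in> topspace (realization K) \<times> {-1..1}. susp_to_join a b (susp_proj p) \<in> U}} =
      {p \<in> topspace ?C. cone_map e p \<in> closed_simplex (insert e \<tau>) \<inter> U}"
    using \<tau> k cone_map_in_closed_simplex[of \<tau>] K[OF \<tau>] by auto
  finally have preimage: "openin ?C {p \<in> topspace ?C. cone_map e p \<in> closed_simplex (insert e \<tau>) \<inter> U}" .
  have "quotient_map ?C (top_of_set (closed_simplex (insert e \<tau>))) (cone_map e)"
    by (intro quotient_map_cone_map) (use K[OF \<tau>] e in auto)
  then have quot: "openin ?C {p \<in> topspace ?C. cone_map e p \<in> V} \<longleftrightarrow>
      openin (top_of_set (closed_simplex (insert e \<tau>))) V" if "V \<subseteq> closed_simplex (insert e \<tau>)" for V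
    using that unfolding quotient_map_def topspace_euclidean_subtopology by blast
  show ?thesis using preimage unfolding quot[OF Int_lower1] .
qed

text \<open>Openness is tested on each simplex of the join: the cones are covered by
  \<open>openin_cone\<close>, their faces are subspaces, and a pole is a single point.\<close>

lemma openin_join:
  assumes U: "U \<subseteq> topspace (realization (simplicial_join {{a}, {b}} K))"
    and open_susp: "openin (suspension (realization K))
      {z \<in> susp_carrier (topspace (realization K)). susp_to_join a b z \<in> U}"
  shows "openin (realization (simplicial_join {{a}, {b}} K)) U"
  unfolding openin_realization
proof (intro conjI ballI)
  let ?J = "simplicial_join {{a}, {b}} K"
  show "U \<subseteq> (\<Union>\<sigma>\<in>?J. closed_simplex \<sigma>)" using U by simp
  note P = open_susp[unfolded openin_suspension_preimage]
  have cone_a: "openin (top_of_set (closed_simplex (insert a \<tau>))) (closed_simplex (insert a \<tau>) \<inter> U)"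
    if "\<tau> \<in> K" for \<tau>
    by (rule openin_cone[OF P that a[OF that], where k = "\<lambda>u. u - 1"])
      (auto intro!: continuous_intros susp_to_join_susp_proj)
  have cone_b: "openin (top_of_set (closed_simplex (insert b \<tau>))) (closed_simplex (insert b \<tau>) \<inter> U)"
    if "\<tau> \<in> K" for \<tau>
    by (rule openin_cone[OF P that b[OF that], where k = "\<lambda>u. 1 - u"])
      (auto intro!: continuous_intros susp_to_join_susp_proj)
  have point: "openin (top_of_set (closed_simplex {e})) (U \<inter> closed_simplex {e})" for e
  proof -
    have "closed_simplex {e} = {vertex_point e}"
      by (auto simp: closed_simplex_def vertex_point_def)
    moreover have "U \<inter> {z} = {} \<or> U \<inter> {z} = {z}" for z by auto
    ultimately show ?thesis by (metis openin_empty openin_topspace topspace_euclidean_subtopology)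
  qed
  have face: "openin (top_of_set (closed_simplex \<rho>)) (U \<inter> closed_simplex \<rho>)"
    if "openin (top_of_set (closed_simplex \<tau>)) (closed_simplex \<tau> \<inter> U)" "finite \<tau>" "\<rho> \<subseteq> \<tau>" for \<rho> \<tau>
    using openin_subtopology_Int_subset[OF that(1) closed_simplex_mono[OF that(2,3)]]
    by (simp add: Int_commute)
  fix \<rho> assume "\<rho> \<in> ?J"
  then show "openin (top_of_set (closed_simplex \<rho>)) (U \<inter> closed_simplex \<rho>)"
  proof (cases rule: join_simplex_cases)
    case (3 \<tau>)
    then show ?thesis using face[OF cone_a] K by blast
  next
    case (4 \<tau>)
    then show ?thesis using face[OF cone_b] K by blast
  qed (use point in auto)
qed

lemma susp_to_join_image:
  "susp_to_join a b ` susp_carrier (topspace (realization K)) =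
     topspace (realization (simplicial_join {{a}, {b}} K))"
proof (rule antisym)
  let ?J = "simplicial_join {{a}, {b}} K"
  show "susp_to_join a b ` susp_carrier (topspace (realization K)) \<subseteq> topspace (realization ?J)"
    using continuous_map_image_subset_topspace[OF continuous_map_susp_to_join] by simp
  have cone: "y \<in> susp_to_join a b ` susp_carrier (topspace (realization K))"
    if "\<tau> \<in> K" "y \<in> closed_simplex (insert e \<tau>)" "e = a \<or> e = b" for \<tau> y e
  proof -
    have "y \<in> cone_map e ` (closed_simplex \<tau> \<times> {0..1})"
      using that K[OF that(1)] a b cone_map_image[of \<tau> e] by auto
    then obtain x u where x: "x \<in> closed_simplex \<tau>" "u \<in> {0..1}" "y = cone_map e (x, u)" by auto
    have "x \<in> topspace (realization K)" using that(1) x(1) by auto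
    then have "susp_proj (x, s) \<in> susp_carrier (topspace (realization K))" for s
      by (rule susp_proj_in_carrier)
    then show ?thesis using that(3) x(2,3) susp_to_join_susp_proj[of u a b x] by (metis image_eqI)
  qed
  \<comment> \<open>The poles are treated separately because no cone contains them when
    \<open>K\<close> is empty.\<close>
  have poles: "vertex_point a \<in> susp_to_join a b ` susp_carrier S"
    "vertex_point b \<in> susp_to_join a b ` susp_carrier S" for S
    using imageI[of South _ "susp_to_join a b"] imageI[of North _ "susp_to_join a b"]
    by (auto simp: susp_carrier_def)
  have point: "y = vertex_point e" if "y \<in> closed_simplex {e}" for y e
    using that by (auto simp: closed_simplex_def vertex_point_def)
  show "topspace (realization ?J) \<subseteq> susp_to_join a b ` susp_carrier (topspace (realization K))"
  proof
    fix y assume "y \<in> topspace (realization ?J)"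
    then obtain \<rho> where "\<rho> \<in> ?J" and y: "y \<in> closed_simplex \<rho>" by auto
    from \<open>\<rho> \<in> ?J\<close> show "y \<in> susp_to_join a b ` susp_carrier (topspace (realization K))"
    proof (cases rule: join_simplex_cases)
      case 1
      then show ?thesis using poles(1) point y by metis
    next
      case 2
      then show ?thesis using poles(2) point y by metis
    next
      case (3 \<tau>)
      then show ?thesis using cone[of \<tau> y a] K y closed_simplex_mono[of "insert a \<tau>" \<rho>] by auto
    next
      case (4 \<tau>)
      then show ?thesis using cone[of \<tau> y b] K y closed_simplex_mono[of "insert b \<tau>" \<rho>] by auto
    qed
  qed
qed

text \<open>Points of \<open>K\<close> vanish at \<open>a\<close> and \<open>b\<close>, so the
  difference of these two coordinates recovers the height; off the poles the base point is then
  determined.\<close>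

lemma inj_on_susp_to_join: "inj_on (susp_to_join a b) (susp_carrier (topspace (realization K)))"
proof -
  define height :: "('b \<Rightarrow> real) susp \<Rightarrow> real" where
    "height z = (case z of South \<Rightarrow> -1 | North \<Rightarrow> 1 | Band x s \<Rightarrow> s)" for z
  have zero: "x a = 0" "x b = 0" if "x \<in> topspace (realization K)" for x
    using that a b by (auto simp: closed_simplex_def)
  have height: "susp_to_join a b z b - susp_to_join a b z a = height z"
    if "z \<in> susp_carrier (topspace (realization K))" for z
  proof (cases z)
    case (Band x s)
    then have "x a = 0" "x b = 0" using that zero[of x] by (auto simp: susp_carrier_def)
    then show ?thesis using Band ab by (simp add: height_def vertex_point_def)
  qed (use ab in \<open>simp_all add: height_def vertex_point_def\<close>)
  show ?thesis
  proof (rule inj_onI)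
    fix z w assume zw: "z \<in> susp_carrier (topspace (realization K))"
      "w \<in> susp_carrier (topspace (realization K))" and eq: "susp_to_join a b z = susp_to_join a b w"
    then have h: "height z = height w" using height by metis
    consider "z = South" | "z = North" | x s where "z = Band x s" "-1 < s" "s < 1"
      using zw(1) by (auto simp: susp_carrier_def)
    then show "z = w"
    proof cases
      case 3
      then obtain y where w: "w = Band y s"
        using zw(2) h by (auto simp: susp_carrier_def height_def)
      \<comment> \<open>The contributions of the poles cancel, and the remaining factor
        \<open>1 - \<bar>s\<bar>\<close> is nonzero.\<close>
      have "x c = y c" for c
        using fun_cong[OF eq, of c] 3 w by (simp add: abs_if split: if_splits)
      then have "x = y" by (rule ext)
      then show ?thesis using 3 w by simp
    qed (use zw(2) h in \<open>auto simp: susp_carrier_def height_def\<close>)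
  qed
qed

text \<open>A homeomorphism is an injective quotient map; the two halves of the quotient condition
  are continuity and \<open>openin_join\<close>.\<close>

lemma homeomorphic_map_susp_to_join:
  "homeomorphic_map (suspension (realization K)) (realization (simplicial_join {{a}, {b}} K))
     (susp_to_join a b)"
  unfolding homeomorphic_map_def quotient_map_def topspace_suspension
proof (intro conjI allI impI inj_on_susp_to_join susp_to_join_image)
  let ?J = "simplicial_join {{a}, {b}} K"
  fix U assume "U \<subseteq> topspace (realization ?J)"
  then show "openin (suspension (realization K))
      {z \<in> susp_carrier (topspace (realization K)). susp_to_join a b z \<in> U} = openin (realization ?J) U"
    using openin_join openin_continuous_map_preimage[OF continuous_map_susp_to_join] by auto
qed

end

section \<open>The T-operation\<close>

definition linear_complex :: "('a \<times> 'a) set \<Rightarrow> ('a \<times> 'a) set set" where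
  "linear_complex E = {S. S \<subseteq> E \<and> finite S \<and> S \<noteq> {} \<and> linear_arcs S}"

text \<open>\<open>E\<close> stands for the arcs of the original digraph, \<open>d\<close> and
  \<open>g\<close> for the poles of the suspension, and \<open>A\<close> for the two new arcs that
  are collapsed onto \<open>d\<close>.\<close>

context
  fixes E A :: "('a \<times> 'a) set" and d g :: "'a \<times> 'a"
  assumes fresh: "d \<notin> E" "g \<notin> E" "d \<notin> A" "g \<notin> A" "E \<inter> A = {}" "d \<noteq> g" and fin: "finite A"
    and not_d_g: "\<And>S. linear_arcs S \<Longrightarrow> d \<in> S \<Longrightarrow> g \<notin> S"
    and not_A_g: "\<And>S. linear_arcs S \<Longrightarrow> S \<inter> A \<noteq> {} \<Longrightarrow> g \<notin> S"
    and insert_d: "\<And>S. S \<subseteq> E \<union> A \<Longrightarrow> linear_arcs S \<Longrightarrow> linear_arcs (insert d S)"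
    and insert_g: "\<And>S. S \<subseteq> E \<Longrightarrow> linear_arcs S \<Longrightarrow> linear_arcs (insert g S)"
begin

lemma linear_complex_join_subset:
  "simplicial_join {{d}, {g}} (linear_complex E) \<subseteq> linear_complex (E \<union> {d, g} \<union> A)"
proof
  fix \<sigma> assume "\<sigma> \<in> simplicial_join {{d}, {g}} (linear_complex E)"
  then obtain \<tau> where \<sigma>: "\<sigma> \<noteq> {}" "\<sigma> = \<tau> \<or> \<sigma> = insert d \<tau> \<or> \<sigma> = insert g \<tau>"
    and \<tau>: "\<tau> = {} \<or> \<tau> \<in> linear_complex E"
    unfolding simplicial_join_two_points by blast
  from \<tau> have \<tau>: "\<tau> \<subseteq> E" "finite \<tau>" "linear_arcs \<tau>"
    by (auto simp: linear_complex_def linear_arcs_empty)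
  then have "linear_arcs (insert d \<tau>)" "linear_arcs (insert g \<tau>)"
    by (auto intro: insert_d insert_g)
  then show "\<sigma> \<in> linear_complex (E \<union> {d, g} \<union> A)"
    using \<sigma> \<tau> by (auto simp: linear_complex_def)
qed

text \<open>As \<open>d\<close> and \<open>g\<close> exclude each other, what remains is the part in
  \<open>E\<close> together with at most one pole.\<close>

lemma linear_complex_delete:
  assumes "\<sigma> \<in> linear_complex (E \<union> {d, g} \<union> A)" "\<sigma> - A \<noteq> {}"
  shows "\<sigma> - A \<in> simplicial_join {{d}, {g}} (linear_complex E)"
proof -
  have \<sigma>: "\<sigma> \<subseteq> E \<union> {d, g} \<union> A" "finite \<sigma>" "linear_arcs \<sigma>"
    using assms(1) by (auto simp: linear_complex_def)
  have "\<sigma> \<inter> E = {} \<or> \<sigma> \<inter> E \<in> linear_complex E"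
    using \<sigma> linear_arcs_subset[of \<sigma> "\<sigma> \<inter> E"] by (auto simp: linear_complex_def)
  moreover have "\<sigma> - A = \<sigma> \<inter> E \<or> \<sigma> - A = insert d (\<sigma> \<inter> E) \<or> \<sigma> - A = insert g (\<sigma> \<inter> E)"
    using \<sigma>(1) fresh not_d_g[OF \<sigma>(3)] by auto
  ultimately show ?thesis
    using assms(2) unfolding simplicial_join_two_points by blast
qed

text \<open>Meeting \<open>A\<close> excludes \<open>g\<close>. Since \<open>d\<close> may already
  be present, it is removed first, so that \<open>insert_d\<close> applies to a subset of
  \<open>E \<union> A\<close>.\<close>

lemma linear_complex_dominated:
  assumes "\<sigma> \<in> linear_complex (E \<union> {d, g} \<union> A)" "\<sigma> \<inter> A \<noteq> {}"
  shows "insert d \<sigma> \<in> linear_complex (E \<union> {d, g} \<union> A)"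
proof -
  have \<sigma>: "\<sigma> \<subseteq> E \<union> {d, g} \<union> A" "finite \<sigma>" "linear_arcs \<sigma>"
    using assms(1) by (auto simp: linear_complex_def)
  then have "\<sigma> - {d} \<subseteq> E \<union> A" using not_A_g[OF \<sigma>(3) assms(2)] by blast
  then have "linear_arcs (insert d (\<sigma> - {d}))"
    using \<sigma>(3) by (intro insert_d) (auto intro: linear_arcs_subset)
  then show ?thesis using \<sigma> by (auto simp: linear_complex_def)
qed

lemma homotopy_equivalence_map_linear_complex:
  "homotopy_equivalence_map (realization (simplicial_join {{d}, {g}} (linear_complex E)))
     (realization (linear_complex (E \<union> {d, g} \<union> A))) id"
proof (rule homotopy_equivalence_map_dominated[where A = A and d = d])
  fix \<sigma> assume "\<sigma> \<in> simplicial_join {{d}, {g}} (linear_complex E)"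
  then show "\<sigma> \<inter> A = {}"
    using fresh unfolding simplicial_join_two_points by (auto simp: linear_complex_def)
next
  show "\<sigma> - A \<in> simplicial_join {{d}, {g}} (linear_complex E)"
    if "\<sigma> \<in> linear_complex (E \<union> {d, g} \<union> A)" "\<sigma> - A \<noteq> {}" for \<sigma>
    using that by (rule linear_complex_delete)
  show "insert d \<sigma> \<in> linear_complex (E \<union> {d, g} \<union> A)"
    if "\<sigma> \<in> linear_complex (E \<union> {d, g} \<union> A)" "\<sigma> \<inter> A \<noteq> {}" for \<sigma>
    using that by (rule linear_complex_dominated)
  show "finite \<sigma>" if "\<sigma> \<in> linear_complex (E \<union> {d, g} \<union> A)" for \<sigma>
    using that by (simp add: linear_complex_def)
  show "{} \<notin> linear_complex (E \<union> {d, g} \<union> A)"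
    by (simp add: linear_complex_def)
qed (fact linear_complex_join_subset fin fresh(3))+

end

section \<open>The two gluings\<close>

text \<open>The pole \<open>(t, t1)\<close> shares its target with \<open>(t2, t1)\<close>, shares
  its source with \<open>(t, v)\<close>, and forms a 2-cycle with \<open>(t1, t)\<close>.\<close>

lemma T_operation_A_complexes:
  assumes G': "pair_wf_digraph G'" and T: "T_operation_A G' v t t1 t2 G''"
  defines "J \<equiv> simplicial_join {{(t2, t1)}, {(t, t1)}} (multipath_complex G')"
  shows "J \<subseteq> multipath_complex G''"
    and "homotopy_equivalence_map (realization J) (realization (multipath_complex G'')) id"
proof -
  interpret pair_wf_digraph G' by fact
  let ?A = "{(t, v), (t1, t)}"
  have new: "t1 \<notin> pverts G'" "t2 \<notin> pverts G'" "t1 \<noteq> t2" "t \<in> pverts G'" "t \<noteq> v"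
    and inc: "incident_arcs G' t = {(v, t)}"
    and G''_eq: "G'' = \<lparr>pverts = pverts G' \<union> {t1, t2},
      parcs = parcs G' \<union> {(t, v), (t1, t), (t, t1), (t2, t1)}\<rparr>"
    using T by (simp_all add: T_operation_A_def)
  have t: "e = (v, t)" if "e \<in> parcs G'" "fst e = t \<or> snd e = t" for e
    using inc that unfolding incident_arcs_def by blast
  have vt: "(v, t) \<in> parcs G'" using inc unfolding incident_arcs_def by blast
  have v: "v \<in> pverts G'" using vt by (rule in_arcsD1)
  \<comment> \<open>The last clause is what admits \<open>(t, t1)\<close>: the only old arc at
    \<open>t\<close> enters it, so no old arc starts there.\<close>
  have ends: "fst e \<noteq> t1" "snd e \<noteq> t1" "fst e \<noteq> t2" "snd e \<noteq> t2" "fst e \<noteq> t" if "e \<in> parcs G'" for e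
    using new arc_fst_in_verts[OF that] arc_snd_in_verts[OF that] t[OF that] by (metis fst_conv snd_conv)+
  have neq: "t \<noteq> t1" "t \<noteq> t2" "v \<noteq> t1" "v \<noteq> t2" using new v by auto
  have G'': "pair_wf_digraph G''"
    using G''_eq new v by unfold_locales (auto dest: arc_fst_in_verts arc_snd_in_verts)
  have arcs: "parcs G'' = parcs G' \<union> {(t2, t1), (t, t1)} \<union> ?A"
    using G''_eq by auto
  note complexes = multipath_complex_eq[OF G', folded linear_complex_def]
    multipath_complex_eq[OF G'', folded linear_complex_def] arcs
  have fresh: "(t2, t1) \<notin> parcs G'" "(t, t1) \<notin> parcs G'" "(t2, t1) \<notin> ?A" "(t, t1) \<notin> ?A"
    "parcs G' \<inter> ?A = {}" "(t2, t1) \<noteq> (t, t1)"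
    using ends(1,2,5) neq new by fastforce+
  have not_d_g: "(t, t1) \<notin> S" if "linear_arcs S" "(t2, t1) \<in> S" for S
    using linear_arcsD[OF that, of "(t, t1)"] neq by auto
  have not_A_g: "(t, t1) \<notin> S" if "linear_arcs S" "S \<inter> ?A \<noteq> {}" for S
    using that linear_arcsD[of S "(t, v)" "(t, t1)"] linear_arcs_no_2_cycle[of S t1 t] neq by auto
  \<comment> \<open>Neither \<open>E\<close> nor \<open>A\<close> has an arc at \<open>t2\<close>,
    and the only arc at \<open>t1\<close> among them leaves it.\<close>
  have insert_d: "linear_arcs (insert (t2, t1) S)" if "S \<subseteq> parcs G' \<union> ?A" "linear_arcs S" for S
    by (rule linear_arcs_insert[OF that(2)]) (use that(1) ends neq new in fastforce)+
  have insert_g: "linear_arcs (insert (t, t1) S)" if "S \<subseteq> parcs G'" "linear_arcs S" for S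
    by (rule linear_arcs_insert[OF that(2)]) (use that(1) ends neq in fastforce)+
  note collapse = fresh _ not_d_g not_A_g insert_d insert_g
  show "J \<subseteq> multipath_complex G''"
    unfolding J_def complexes by (rule linear_complex_join_subset[OF collapse]) auto
  show "homotopy_equivalence_map (realization J) (realization (multipath_complex G'')) id"
    unfolding J_def complexes by (rule homotopy_equivalence_map_linear_complex[OF collapse]) auto
qed

text \<open>Now the only old arc at \<open>t\<close> leaves it. The pole \<open>(w2, t)\<close>
  shares its source with \<open>(w2, w3)\<close>, shares its target with \<open>(v, t)\<close>, and
  forms a 2-cycle with \<open>(t, w2)\<close>.\<close>

lemma T_operation_B_complexes:
  assumes G': "pair_wf_digraph G'" and T: "T_operation_B G' v t w2 w3 G''"
  defines "J \<equiv> simplicial_join {{(w2, w3)}, {(w2, t)}} (multipath_complex G')"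
  shows "homotopy_equivalence_map (realization J) (realization (multipath_complex G'')) id"
proof -
  interpret pair_wf_digraph G' by fact
  let ?A = "{(v, t), (t, w2)}"
  have new: "w2 \<notin> pverts G'" "w3 \<notin> pverts G'" "w2 \<noteq> w3" "t \<in> pverts G'" "t \<noteq> v"
    and inc: "incident_arcs G' t = {(t, v)}"
    and G''_eq: "G'' = \<lparr>pverts = pverts G' \<union> {w2, w3},
      parcs = parcs G' \<union> {(v, t), (t, w2), (w2, t), (w2, w3)}\<rparr>"
    using T by (simp_all add: T_operation_B_def)
  have t: "e = (t, v)" if "e \<in> parcs G'" "fst e = t \<or> snd e = t" for e
    using inc that unfolding incident_arcs_def by blast
  have tv: "(t, v) \<in> parcs G'" using inc unfolding incident_arcs_def by blast
  have v: "v \<in> pverts G'" using tv by (rule in_arcsD2)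
  have ends: "fst e \<noteq> w2" "snd e \<noteq> w2" "fst e \<noteq> w3" "snd e \<noteq> w3" "snd e \<noteq> t" if "e \<in> parcs G'" for e
    using new arc_fst_in_verts[OF that] arc_snd_in_verts[OF that] t[OF that] by (metis fst_conv snd_conv)+
  have neq: "t \<noteq> w2" "t \<noteq> w3" "v \<noteq> w2" "v \<noteq> w3" using new v by auto
  have G'': "pair_wf_digraph G''"
    using G''_eq new v by unfold_locales (auto dest: arc_fst_in_verts arc_snd_in_verts)
  have arcs: "parcs G'' = parcs G' \<union> {(w2, w3), (w2, t)} \<union> ?A"
    using G''_eq by auto
  note complexes = multipath_complex_eq[OF G', folded linear_complex_def]
    multipath_complex_eq[OF G'', folded linear_complex_def] arcs
  have fresh: "(w2, w3) \<notin> parcs G'" "(w2, t) \<notin> parcs G'" "(w2, w3) \<notin> ?A" "(w2, t) \<notin> ?A"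
    "parcs G' \<inter> ?A = {}" "(w2, w3) \<noteq> (w2, t)"
    using ends(1,2,5) neq new by fastforce+
  have not_d_g: "(w2, t) \<notin> S" if "linear_arcs S" "(w2, w3) \<in> S" for S
    using linear_arcsD[OF that, of "(w2, t)"] neq by auto
  have not_A_g: "(w2, t) \<notin> S" if "linear_arcs S" "S \<inter> ?A \<noteq> {}" for S
    using that linear_arcsD[of S "(v, t)" "(w2, t)"] linear_arcs_no_2_cycle[of S t w2] neq by auto
  have insert_d: "linear_arcs (insert (w2, w3) S)" if "S \<subseteq> parcs G' \<union> ?A" "linear_arcs S" for S
    by (rule linear_arcs_insert[OF that(2)]) (use that(1) ends neq new in fastforce)+
  have insert_g: "linear_arcs (insert (w2, t) S)" if "S \<subseteq> parcs G'" "linear_arcs S" for S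
  proof -
    \<comment> \<open>No old arc touches \<open>w2\<close> and none enters \<open>t\<close>; in
      particular nothing enters the source of the new arc, which rules out a cycle.\<close>
    have "w2 \<notin> fst ` S" "t \<notin> snd ` S" "w2 \<notin> snd ` S" using that(1) ends by blast+
    then show ?thesis using that(2) neq by (intro linear_arcs_insert) auto
  qed
  note collapse = fresh _ not_d_g not_A_g insert_d insert_g
  show ?thesis
    unfolding J_def complexes by (rule homotopy_equivalence_map_linear_complex[OF collapse]) auto
qed

lemma homeomorphic_map_susp_to_join_multipath:
  assumes "pair_wf_digraph G" "d \<notin> parcs G" "g \<notin> parcs G" "d \<noteq> g"
  shows "homeomorphic_map (suspension (realization (multipath_complex G)))
    (realization (simplicial_join {{d}, {g}} (multipath_complex G))) (susp_to_join d g)"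
  using assms by (intro homeomorphic_map_susp_to_join) (auto simp: multipath_complex_eq)

lemma homotopy_equivalent_space_homotopy_equivalence_map:
  "homotopy_equivalence_map X Y f \<Longrightarrow> X homotopy_equivalent_space Y"
  unfolding homotopy_equivalence_map_def homotopy_equivalent_space_def by blast

theorem proposition2p3:
  fixes G' G'' :: "'a pair_pre_digraph"
  assumes "pair_wf_digraph G'" and "T_operation G' G''"
  shows "realization (multipath_complex G'') homotopy_equivalent_space
           suspension (realization (multipath_complex G')) \<and>
         (\<forall>v t t1 t2. T_operation_A G' v t t1 t2 G'' \<longrightarrow>
           simplicial_join {{(t2, t1)}, {(t, t1)}} (multipath_complex G')
             \<subseteq> multipath_complex G'' \<and>
           homeomorphic_map
             (suspension (realization (multipath_complex G')))
             (realization (simplicial_join {{(t2, t1)}, {(t, t1)}} (multipath_complex G')))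
             (susp_to_join (t2, t1) (t, t1)) \<and>
           homotopy_equivalence_map
             (realization (simplicial_join {{(t2, t1)}, {(t, t1)}} (multipath_complex G')))
             (realization (multipath_complex G''))
             id)"
proof -
  interpret pair_wf_digraph G' by fact
  let ?susp = "suspension (realization (multipath_complex G'))"
  \<comment> \<open>Both poles end in the fresh vertex \<open>t1\<close>, so they are not arcs of
    \<open>G'\<close>; in case (B) both start in the fresh vertex \<open>w2\<close>.\<close>
  have homeo_A: "homeomorphic_map ?susp
      (realization (simplicial_join {{(t2, t1)}, {(t, t1)}} (multipath_complex G')))
      (susp_to_join (t2, t1) (t, t1))" if "T_operation_A G' v t t1 t2 G''" for v t t1 t2
    using that in_arcsD2
    by (intro homeomorphic_map_susp_to_join_multipath assms(1)) (auto simp: T_operation_A_def)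
  have homeo_B: "homeomorphic_map ?susp
      (realization (simplicial_join {{(w2, w3)}, {(w2, t)}} (multipath_complex G')))
      (susp_to_join (w2, w3) (w2, t))" if "T_operation_B G' v t w2 w3 G''" for v t w2 w3
    using that in_arcsD1
    by (intro homeomorphic_map_susp_to_join_multipath assms(1)) (auto simp: T_operation_B_def)
  \<comment> \<open>In both cases the equivalence factors through the join \<open>Y\<close>: a
    homeomorphism from the suspension, then the inclusion.\<close>
  have "realization (multipath_complex G'') homotopy_equivalent_space ?susp"
    if "homeomorphic_map ?susp Y f" "homotopy_equivalence_map Y (realization (multipath_complex G'')) id"
    for Y f
  proof (rule homotopy_eqv_trans)
    show "realization (multipath_complex G'') homotopy_equivalent_space Y"
      using that(2) homotopy_equivalent_space_homotopy_equivalence_map homotopy_equivalent_space_sym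
      by blast
    show "Y homotopy_equivalent_space ?susp"
      using that(1) homeomorphic_map_imp_homeomorphic_space homeomorphic_imp_homotopy_equivalent_space
        homotopy_equivalent_space_sym by blast
  qed
  then have "realization (multipath_complex G'') homotopy_equivalent_space ?susp"
    using assms(2) homeo_A T_operation_A_complexes(2)[OF assms(1)]
      homeo_B T_operation_B_complexes[OF assms(1)]
    unfolding T_operation_def by blast
  then show ?thesis
    using homeo_A T_operation_A_complexes[OF assms(1)] by blast
qed

end
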